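(* Let $q>1$ and let $\mathfrak{G}_\Gamma$ be a finite $(q+1)$-regular graph. Given a weight function $f\in C^{\mathrm{lc}}(\mathfrak{P}_\Gamma)$, the weighted dynamical Ihara zeta function $\mathbf{Z}_f(s)$ at $s\in\mathbb{C}$ coincides with the logarithmic derivative of the dynamical determinant $d_f$ with respect to $\beta$, evaluated at $\beta=0$: $$\mathbf{Z}_f(s)=\frac{\partial_\beta d_f(s,0)}{d_f(s,0)}.$$
   Context: $\mathfrak{G}_\Gamma$ is a finite connected simple $(q+1)$-regular graph with directed edges closed under reversal; $\iota,\tau$ denote initial/terminal vertex and $\vec e^{\,\mathrm{op}}$ the reversed edge. A sequence of edges is admissible if consecutive edges $\vec a,\vec b$ satisfy $\tau(\vec a)=\iota(\vec b)$, $\vec b\ne\vec a^{\,\mathrm{op}}$. $\mathfrak{P}_\Gamma$ is the space of pairs $((\vec e_1,\vec e_2,\ldots),(\ldots,\vec b_2,\vec b_1))$ such that $(\ldots,\vec b_2,\vec b_1,\vec e_1,\vec e_2,\ldots)$ is an admissible bi-infinite chain, with shift $\sigma((\vec e_1,\vec e_2,\ldots),(\ldots,\vec b_1))=((\vec e_2,\ldots),(\ldots,\vec b_1,\vec e_1))$. $C^{\mathrm{lc}}(\mathfrak{P}_\Gamma)$: locally constant complex functions. A closed path of length $n\ge3$ is an admissible $(\vec e_1,\ldots,\vec e_n)$ with $\tau(\vec e_n)=\iota(\vec e_1)$, $\vec e_1\ne\vec e_n^{\,\mathrm{op}}$; primitive means not a repetition of a shorter closed path; $\mathscr{P}_0$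 is the set of primitive closed paths modulo cyclic rotation, $\ell_0$ the length of $[\mathbf{p}_0]$, $\widehat{\mathbf{p}}_0\in\mathfrak{P}_\Gamma$ the bi-infinite periodic repetition of a representative, $\mathbf{f}_{\ell_0}(\widehat{\mathbf{p}}_0)=\sum_{k=0}^{\ell_0-1}f(\sigma^k(\widehat{\mathbf{p}}_0))$. Then $$\mathbf{Z}_f(s)=\sum_{[\mathbf{p}_0]\in\mathscr{P}_0}\frac{q^{(\frac12+is)\ell_0}}{1-q^{(\frac12+is)\ell_0}}\mathbf{f}_{\ell_0}(\widehat{\mathbf{p}}_0),\qquad d_f(s,\beta)=\exp\Big(-\sum_{k=1}^\infty\sum_{[\mathbf{p}_0]\in\mathscr{P}_0}\frac{q^{(\frac12+is)k\ell_0}}{k}e^{-k\beta\,\mathbf{f}_{\ell_0}(\widehat{\mathbf{p}}_0)}\Big).$$ The series for $\mathbf{Z}_f(s)$ converges absolutely for $\mathrm{Im}(s)>\frac32$, and the series in $d_f(s,\beta)$ converges absolutely when, additionally, $\beta$ is close enough to $0$ (depending on $s$). Outside these domains $\mathbf{Z}_f$ denotes the meromorphic continuation to $\mathbb{C}$ and $d_f$ the holomorphic continuation to $\mathbb{C}^2$; the identity is one of meromorphic functions of $s$. *)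

theory Defs
  imports
    "Graph_Theory.Pair_Digraph"
    "Graph_Theory.Digraph_Component"
    "HOL-Complex_Analysis.Complex_Analysis"
begin

text \<open>
  Simple graphs are symmetric loop-free digraphs whose arcs are ordered pairs of vertices
  (\<^locale>\<open>pair_graph\<close>), so that the initial vertex, the terminal vertex and the reversal of
  an edge are \<^const>\<open>fst\<close>, \<^const>\<open>snd\<close> and \<^const>\<open>prod.swap\<close>.
\<close>

definition regular_graph :: "nat \<Rightarrow> 'v pair_pre_digraph \<Rightarrow> bool" where
  "regular_graph d G \<longleftrightarrow>
     pair_graph G \<and> Digraph_Component.connected (with_proj G) \<and>
     (\<forall>v \<in> pverts G. out_degree (with_proj G) v = d)"

definition admissible :: "'v \<times> 'v \<Rightarrow> 'v \<times> 'v \<Rightarrow> bool" where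
  "admissible a b \<longleftrightarrow> snd a = fst b \<and> b \<noteq> prod.swap a"

text \<open>
  A pair \<open>(e, b)\<close> stands for the chain \<open>(\<dots>, b 1, b 0, e 0, e 1, \<dots>)\<close>; indices start at 0.
\<close>

type_synonym 'v chain = "(nat \<Rightarrow> 'v \<times> 'v) \<times> (nat \<Rightarrow> 'v \<times> 'v)"

definition chains :: "'v pair_pre_digraph \<Rightarrow> 'v chain set" where
  "chains G = {(e, b).
     (\<forall>i. e i \<in> parcs G) \<and> (\<forall>i. b i \<in> parcs G) \<and>
     (\<forall>i. admissible (e i) (e (Suc i))) \<and>
     (\<forall>i. admissible (b (Suc i)) (b i)) \<and>
     admissible (b 0) (e 0)}"

definition chain_topology :: "'v pair_pre_digraph \<Rightarrow> 'v chain topology" where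
  "chain_topology G =
     subtopology
       (prod_topology
         (product_topology (\<lambda>_::nat. discrete_topology (parcs G)) UNIV)
         (product_topology (\<lambda>_::nat. discrete_topology (parcs G)) UNIV))
       (chains G)"

text \<open>The values of \<open>f\<close> outside \<^term>\<open>chains G\<close> are irrelevant throughout.\<close>

definition locally_constant :: "'v pair_pre_digraph \<Rightarrow> ('v chain \<Rightarrow> complex) \<Rightarrow> bool" where
  "locally_constant G f \<longleftrightarrow>
     (\<forall>x \<in> chains G. \<exists>U. openin (chain_topology G) U \<and> x \<in> U \<and> (\<forall>y \<in> U. f y = f x))"

definition shift :: "'v chain \<Rightarrow> 'v chain" where
  "shift = (\<lambda>(e, b). (\<lambda>i. e (Suc i), case_nat (e 0) b))"

definition closed_path :: "'v pair_pre_digraph \<Rightarrow> ('v \<times> 'v) list \<Rightarrow> bool" where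
  "closed_path G p \<longleftrightarrow>
     3 \<le> length p \<and> set p \<subseteq> parcs G \<and>
     (\<forall>i. Suc i < length p \<longrightarrow> admissible (p ! i) (p ! Suc i)) \<and>
     snd (last p) = fst (hd p) \<and> hd p \<noteq> prod.swap (last p)"

definition primitive_path :: "'v pair_pre_digraph \<Rightarrow> ('v \<times> 'v) list \<Rightarrow> bool" where
  "primitive_path G p \<longleftrightarrow>
     closed_path G p \<and>
     \<not> (\<exists>r m. closed_path G r \<and> length r < length p \<and> p = concat (replicate m r))"

definition primitive_classes :: "'v pair_pre_digraph \<Rightarrow> ('v \<times> 'v) list set set" where
  "primitive_classes G =
     {p. primitive_path G p} //
     {(p, p'). primitive_path G p \<and> primitive_path G p' \<and> (\<exists>n. p' = rotate n p)}"

text \<open>The first edge of the path is the one at index 0 on the forward side.\<close>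

definition periodic_chain :: "('v \<times> 'v) list \<Rightarrow> 'v chain" where
  "periodic_chain p =
     (\<lambda>i. p ! (i mod length p), \<lambda>i. p ! (length p - 1 - i mod length p))"

text \<open>Neither of the following two depends on the representative that is chosen.\<close>

definition class_length :: "('v \<times> 'v) list set \<Rightarrow> nat" where
  "class_length c = length (SOME p. p \<in> c)"

definition class_weight :: "('v chain \<Rightarrow> complex) \<Rightarrow> ('v \<times> 'v) list set \<Rightarrow> complex" where
  "class_weight f c = (\<Sum>k<class_length c. f ((shift ^^ k) (periodic_chain (SOME p. p \<in> c))))"

definition zeta_series ::
    "'v pair_pre_digraph \<Rightarrow> nat \<Rightarrow> ('v chain \<Rightarrow> complex) \<Rightarrow> complex \<Rightarrow> complex" where
  "zeta_series G q f s =
     (\<Sum>\<^sub>\<infinity>c\<in>primitive_classes G.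
        of_nat q powr ((1/2 + \<i> * s) * of_nat (class_length c)) /
        (1 - of_nat q powr ((1/2 + \<i> * s) * of_nat (class_length c))) *
        class_weight f c)"

definition det_series ::
    "'v pair_pre_digraph \<Rightarrow> nat \<Rightarrow> ('v chain \<Rightarrow> complex) \<Rightarrow> complex \<Rightarrow> complex \<Rightarrow> complex" where
  "det_series G q f s \<beta> =
     exp (- (\<Sum>\<^sub>\<infinity>k\<in>{1::nat..}. \<Sum>\<^sub>\<infinity>c\<in>primitive_classes G.
        of_nat q powr ((1/2 + \<i> * s) * of_nat k * of_nat (class_length c)) / of_nat k *
        exp (- of_nat k * \<beta> * class_weight f c)))"

text \<open>Holomorphy on the whole of \<open>\<complex>\<^sup>2\<close>: the total derivative exists and is complex linear.\<close>

definition holomorphic_C2 :: "(complex \<times> complex \<Rightarrow> complex) \<Rightarrow> bool" where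
  "holomorphic_C2 F \<longleftrightarrow>
     (\<forall>z. \<exists>a b. (F has_derivative (\<lambda>h. a * fst h + b * snd h)) (at z))"

text \<open>
  The two continuations. Uniqueness is the identity theorem; the meromorphic one is unique as a
  function on \<open>\<complex>\<close>, because \<^const>\<open>nicely_meromorphic_on\<close> demands that removable
  singularities are filled in and that the value at a pole is 0.
\<close>

definition ihara_zeta ::
    "'v pair_pre_digraph \<Rightarrow> nat \<Rightarrow> ('v chain \<Rightarrow> complex) \<Rightarrow> complex \<Rightarrow> complex" where
  "ihara_zeta G q f =
     (THE Z. Z nicely_meromorphic_on UNIV \<and> (\<forall>s. Im s > 3/2 \<longrightarrow> Z s = zeta_series G q f s))"

definition dynamical_det ::
    "'v pair_pre_digraph \<Rightarrow> nat \<Rightarrow> ('v chain \<Rightarrow> complex) \<Rightarrow> complex \<times> complex \<Rightarrow> complex" where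
  "dynamical_det G q f =
     (THE D. holomorphic_C2 D \<and>
        (\<forall>s. Im s > 3/2 \<longrightarrow> (\<forall>\<^sub>F \<beta> in nhds 0. D (s, \<beta>) = det_series G q f s \<beta>)))"

end

theory Submission
  imports Defs "Jordan_Normal_Form.Schur_Decomposition"
begin

text \<open>
  A locally constant weight depends on finitely many edges of the chain, so after a shift
  it is a function \<open>g\<close> of the first \<open>m\<close> forward edges. Let \<open>M \<beta>\<close> be the matrix on
  admissible words of length \<open>m\<close> with entry \<open>exp (- \<beta> * g w)\<close> at \<open>(w, w')\<close> when \<open>w'\<close>
  continues \<open>w\<close> by one edge. The trace of its \<open>n\<close>-th power sums \<open>exp (- \<beta> * W p)\<close> over the closed
  paths \<open>p\<close> of length \<open>n\<close>, where \<open>W p\<close> is the total weight. As every closed path is uniquely a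
  power of a primitive one, the series in the dynamical determinant is
  \<open>\<Sum>n. u ^ n / n * trace (M \<beta> ^ n)\<close> with \<open>u = q powr (1/2 + \<i> * s)\<close>, and hence
  \<open>d (s, \<beta>) = det (1 - u * M \<beta>)\<close>, which is entire in both variables. Rows of
  \<open>M \<beta>\<close> have at most \<open>q\<close> nonzero entries, which bounds the eigenvalues and gives absolute convergence
  for \<open>Im s > 3/2\<close>. There the series may be differentiated term by term at \<open>\<beta> = 0\<close>; the result
  is the zeta series, and the identity theorem does the rest.
\<close>

section \<open>Traces and determinants of complex matrices\<close>

hide_const (open) Finite_Cartesian_Product.vec Determinants.det Finite_Cartesian_Product.mat
  Finite_Cartesian_Product.transpose Finite_Cartesian_Product.row Finite_Cartesian_Product.column
no_notation fps_nth (infixl \<open>$\<close> 75)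
no_notation Finite_Cartesian_Product.vec_nth (infixl \<open>$\<close> 90)

text \<open>The passage between classes and closed paths rests on a count: a primitive class of
  length l has exactly l distinct members, so with n = k * l the factor 1/k of a class is l times
  the factor 1/n of a closed path. The trace, in turn, sees cyclic admissible sequences of every
  length, while a closed path has at least 3 edges; the two agree because a sequence of length 1
  would be a loop and one of length 2 would backtrack. The disc of \<beta> on which the exponential
  formula is proved depends on s, so uniqueness of the continuation is argued one variable at a
  time. As both continuations are definite descriptions, nothing can be said of them before
  existence and uniqueness are known. Finally, division by zero yields 0, so at a zero of d (s, 0)
  the raw quotient need not have the value of the continued function; this is why the quotient is
  normalised by \<open>remove_sings\<close>.\<close>

definition mat_trace :: "'a :: comm_monoid_add mat \<Rightarrow> 'a" where
  "mat_trace A = (\<Sum>i<dim_row A. A $$ (i, i))"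

lemma mat_trace_mult_commute:
  fixes A B :: "'a :: comm_semiring_0 mat"
  assumes "A \<in> carrier_mat n n" "B \<in> carrier_mat n n"
  shows "mat_trace (A * B) = mat_trace (B * A)"
proof -
  have "mat_trace (A * B) = (\<Sum>i<n. \<Sum>j<n. A $$ (i, j) * B $$ (j, i))"
    using assms by (auto simp: mat_trace_def scalar_prod_def atLeast0LessThan intro!: sum.cong)
  also have "\<dots> = (\<Sum>j<n. \<Sum>i<n. B $$ (j, i) * A $$ (i, j))"
    by (subst sum.swap) (simp add: mult.commute)
  also have "\<dots> = mat_trace (B * A)"
    using assms by (auto simp: mat_trace_def scalar_prod_def atLeast0LessThan intro!: sum.cong)
  finally show ?thesis .
qed

text \<open>In the entry (i, j) of a product of two upper triangular matrices only the indices l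
  with i \<le> l \<le> j survive: none if j < i, and only l = i on the diagonal.\<close>

lemma upper_triangular_pow_diag:
  fixes B :: "'a :: comm_ring_1 mat"
  assumes B: "B \<in> carrier_mat n n" and ut: "upper_triangular B"
  shows "upper_triangular (B ^\<^sub>m k) \<and> (\<forall>i<n. (B ^\<^sub>m k) $$ (i, i) = (B $$ (i, i)) ^ k)"
proof (induction k)
  case 0
  show ?case using B by auto
next
  case (Suc k)
  let ?C = "B ^\<^sub>m k"
  have C: "?C \<in> carrier_mat n n" using B by simp
  have zC: "?C $$ (i, j) = 0" if "j < i" "i < n" for i j
    using Suc C that by (auto elim: upper_triangularD)
  have zB: "B $$ (i, j) = 0" if "j < i" "i < n" for i j
    using ut B that by (auto elim: upper_triangularD)
  have entry: "(?C * B) $$ (i, j) = (\<Sum>l<n. ?C $$ (i, l) * B $$ (l, j))" if "i < n" "j < n" for i j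
    using that B C by (auto simp: scalar_prod_def atLeast0LessThan)
  have "(?C * B) $$ (i, j) = 0" if "j < i" "i < n" for i j
  proof -
    have "?C $$ (i, l) * B $$ (l, j) = 0" if "l < n" for l
      using zC[of l i] zB[of j l] \<open>j < i\<close> \<open>i < n\<close> that by (cases "l < i") auto
    then show ?thesis using entry[of i j] that by simp
  qed
  moreover have "(?C * B) $$ (i, i) = B $$ (i, i) ^ Suc k" if "i < n" for i
  proof -
    have z: "?C $$ (i, l) * B $$ (l, i) = 0" if "l < n" "l \<noteq> i" for l
      using zC[of l i] zB[of i l] \<open>i < n\<close> that by (cases "l < i") auto
    have "(?C * B) $$ (i, i) = (\<Sum>l<n. if l = i then ?C $$ (i, i) * B $$ (i, i) else 0)"
      unfolding entry[OF that that] using z by (intro sum.cong) auto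
    also have "\<dots> = B $$ (i, i) ^ Suc k"
      using that Suc by simp
    finally show ?thesis .
  qed
  ultimately show ?case
    using B C by (auto intro!: upper_triangularI)
qed

text \<open>One list of eigenvalues with multiplicity has to serve all traces and the determinant at
  once. Schur triangularisation supplies it for every complex matrix, diagonalisable or not, and
  both quantities are invariant under conjugation.\<close>

lemma mat_spectrum:
  fixes A :: "complex mat"
  assumes A: "A \<in> carrier_mat n n"
  obtains es where "length es = n" "\<And>e. e \<in> set es \<Longrightarrow> eigenvalue A e"
    "\<And>k. mat_trace (A ^\<^sub>m k) = (\<Sum>e\<leftarrow>es. e ^ k)"
    "\<And>u. det (1\<^sub>m n - u \<cdot>\<^sub>m A) = (\<Prod>e\<leftarrow>es. 1 - u * e)"
proof -
  obtain es where es: "char_poly A = (\<Prod>e\<leftarrow>es. [:- e, 1:])" "length es = n"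
    using char_poly_factorized[OF A] by blast
  obtain B P Q where "schur_decomposition A es = (B, P, Q)"
    by (cases "schur_decomposition A es")
  then have sim: "similar_mat_wit A B P Q" and ut: "upper_triangular B" and diag: "diag_mat B = es"
    using schur_decomposition[OF A es(1)] by auto
  note simD = similar_mat_witD2[OF A sim]
  have B: "B \<in> carrier_mat n n" and P: "P \<in> carrier_mat n n" and Q: "Q \<in> carrier_mat n n"
    using simD by auto
  have es_nth: "es = map (\<lambda>i. B $$ (i, i)) [0..<n]"
    using diag B by (simp add: diag_mat_def)
  have "eigenvalue A e" if "e \<in> set es" for e
  proof -
    have "poly (char_poly A) e = (\<Prod>x\<leftarrow>es. e - x)"
      unfolding es(1) by (induction es) (auto simp: algebra_simps)
    also have "\<dots> = 0" using that by (auto simp: prod_list_zero_iff)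
    finally show ?thesis using eigenvalue_root_char_poly[OF A] by simp
  qed
  moreover have "mat_trace (A ^\<^sub>m k) = (\<Sum>e\<leftarrow>es. e ^ k)" for k
  proof -
    have Bk: "B ^\<^sub>m k \<in> carrier_mat n n" using B by simp
    have "mat_trace (A ^\<^sub>m k) = mat_trace (P * (B ^\<^sub>m k * Q))"
      using similar_mat_wit_pow_id[OF sim, of k] assoc_mult_mat[OF P Bk Q] by simp
    also have "\<dots> = mat_trace (B ^\<^sub>m k * Q * P)"
      by (rule mat_trace_mult_commute[OF P mult_carrier_mat[OF Bk Q]])
    also have "B ^\<^sub>m k * Q * P = B ^\<^sub>m k"
      using assoc_mult_mat[OF Bk Q P] simD(2) right_mult_one_mat[OF Bk] by simp
    also have "mat_trace (B ^\<^sub>m k) = (\<Sum>i<n. B $$ (i, i) ^ k)"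
      using upper_triangular_pow_diag[OF B ut, of k] B by (simp add: mat_trace_def)
    also have "\<dots> = (\<Sum>e\<leftarrow>es. e ^ k)"
      by (simp add: es_nth sum_list_sum_nth atLeast0LessThan comp_def)
    finally show ?thesis .
  qed
  moreover have "det (1\<^sub>m n - u \<cdot>\<^sub>m A) = (\<Prod>e\<leftarrow>es. 1 - u * e)" for u
  proof -
    let ?X = "1\<^sub>m n - u \<cdot>\<^sub>m B"
    have X: "?X \<in> carrier_mat n n" using B by auto
    have PB: "P * B \<in> carrier_mat n n" using P B by simp
    \<comment> \<open>Conjugation by \<open>P\<close> turns 1 - u B into 1 - u A, since P Q = 1 and
      P B Q = A.\<close>
    have "P * ?X = P * 1\<^sub>m n - P * (u \<cdot>\<^sub>m B)"
      using P B by (intro mult_minus_distrib_mat) auto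
    also have "\<dots> = P - u \<cdot>\<^sub>m (P * B)"
      using mult_smult_distrib[OF P B] right_mult_one_mat[OF P] by simp
    finally have "P * ?X * Q = (P - u \<cdot>\<^sub>m (P * B)) * Q" by simp
    also have "\<dots> = P * Q - u \<cdot>\<^sub>m (P * B) * Q"
      using P PB Q by (intro minus_mult_distrib_mat) auto
    also have "u \<cdot>\<^sub>m (P * B) * Q = u \<cdot>\<^sub>m A"
      using mult_smult_assoc_mat[OF PB Q] simD(3) by simp
    finally have "det (1\<^sub>m n - u \<cdot>\<^sub>m A) = det (P * ?X * Q)"
      using simD(1) by simp
    also have "\<dots> = det P * det ?X * det Q"
      using det_mult[OF mult_carrier_mat[OF P X] Q] det_mult[OF P X] by simp
    also have "\<dots> = det (P * Q) * det ?X"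
      using det_mult[OF P Q] by simp
    finally have "det (1\<^sub>m n - u \<cdot>\<^sub>m A) = det ?X"
      using simD(1) by simp
    moreover have "det ?X = (\<Prod>e\<leftarrow>es. 1 - u * e)"
    proof -
      have "upper_triangular ?X"
        using ut B by (auto intro!: upper_triangularI simp: upper_triangularD[OF ut])
      then have "det ?X = prod_list (diag_mat ?X)"
        using det_upper_triangular X by blast
      also have "diag_mat ?X = map (\<lambda>e. 1 - u * e) es"
        using B by (auto simp: diag_mat_def es_nth)
      finally show ?thesis .
    qed
    ultimately show ?thesis by simp
  qed
  ultimately show ?thesis using that es(2) by blast
qed

text \<open>The eigenvalue equation is read at a coordinate \<open>i\<close> where the eigenvector
  has maximal modulus; all other coordinates are then bounded by that one, which cancels.\<close>

lemma eigenvalue_norm_le_row_sum: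
  fixes A :: "complex mat"
  assumes A: "A \<in> carrier_mat n n" and ev: "eigenvalue A e"
    and row: "\<And>i. i < n \<Longrightarrow> (\<Sum>j<n. norm (A $$ (i, j))) \<le> c"
  shows "norm e \<le> c"
proof -
  obtain v where v: "v \<in> carrier_vec n" "v \<noteq> 0\<^sub>v n" "A *\<^sub>v v = e \<cdot>\<^sub>v v"
    using ev A by (auto simp: eigenvalue_def eigenvector_def)
  then obtain l where l: "l < n" "v $ l \<noteq> 0"
    by (metis carrier_vecD eq_vecI index_zero_vec)
  obtain i where i: "i < n" "\<And>j. j < n \<Longrightarrow> norm (v $ j) \<le> norm (v $ i)"
  proof -
    let ?N = "(\<lambda>j. norm (v $ j)) ` {..<n}"
    have "Max ?N \<in> ?N" using l by (intro Max_in) auto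
    then obtain i where "i < n" "Max ?N = norm (v $ i)" by auto
    moreover have "norm (v $ j) \<le> Max ?N" if "j < n" for j using that by simp
    ultimately have "\<exists>i<n. \<forall>j<n. norm (v $ j) \<le> norm (v $ i)" by auto
    then show ?thesis using that by blast
  qed
  have vi: "norm (v $ i) > 0" using i(2)[OF l(1)] l(2) by (smt (verit) zero_less_norm_iff)
  have "e * v $ i = (\<Sum>j<n. A $$ (i, j) * v $ j)"
  proof -
    have "(A *\<^sub>v v) $ i = (\<Sum>j<n. A $$ (i, j) * v $ j)"
      using A v(1) i(1) by (auto simp: scalar_prod_def atLeast0LessThan)
    then show ?thesis using v i by simp
  qed
  then have "norm e * norm (v $ i) = norm (\<Sum>j<n. A $$ (i, j) * v $ j)"
    by (metis norm_mult)
  also have "\<dots> \<le> (\<Sum>j<n. norm (A $$ (i, j)) * norm (v $ i))"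
    using i(2) by (intro sum_norm_le) (auto simp: norm_mult intro!: mult_left_mono)
  also have "\<dots> \<le> c * norm (v $ i)"
    unfolding sum_distrib_right[symmetric] using row[OF i(1)] by (intro mult_right_mono) auto
  finally show ?thesis using vi by simp
qed

lemma norm_trace_pow_le:
  fixes A :: "complex mat"
  assumes A: "A \<in> carrier_mat n n"
    and row: "\<And>i. i < n \<Longrightarrow> (\<Sum>j<n. norm (A $$ (i, j))) \<le> c"
  shows "norm (mat_trace (A ^\<^sub>m k)) \<le> real n * c ^ k"
proof -
  obtain es where es: "length es = n" "\<And>e. e \<in> set es \<Longrightarrow> eigenvalue A e"
    "mat_trace (A ^\<^sub>m k) = (\<Sum>e\<leftarrow>es. e ^ k)"
    using mat_spectrum[OF A] by metis
  have "norm (\<Sum>i<n. (es ! i) ^ k) \<le> (\<Sum>i<n. c ^ k)"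
    using es eigenvalue_norm_le_row_sum[OF A _ row]
    by (intro sum_norm_le) (auto simp: norm_power intro!: power_mono)
  then show ?thesis using es by (simp add: sum_list_sum_nth atLeast0LessThan)
qed

lemma sums_minus_Ln_one_minus:
  assumes "norm z < 1"
  shows "(\<lambda>k. z ^ Suc k / of_nat (Suc k)) sums (- Ln (1 - z))"
proof -
  have "(\<lambda>n. (-1) ^ Suc n / of_nat n * (-z) ^ n) sums Ln (1 + (-z))"
    using assms by (intro Ln_series) auto
  \<comment> \<open>The term of index 0 is a quotient by 0, hence 0, so the summation may start at
    1.\<close>
  then have "(\<lambda>n. (-1) ^ Suc (Suc n) / of_nat (Suc n) * (-z) ^ Suc n) sums Ln (1 - z)"
    
    using sums_Suc_iff[of "\<lambda>n. (-1) ^ Suc n / of_nat n * (-z) ^ n" "Ln (1 - z)"] by simp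
  then have "(\<lambda>n. - ((-1) ^ Suc (Suc n) / of_nat (Suc n) * (-z) ^ Suc n)) sums (- Ln (1 - z))"
    by (rule sums_minus)
  moreover have "- ((-1) ^ Suc (Suc n) / of_nat (Suc n) * (-z) ^ Suc n) = z ^ Suc n / of_nat (Suc n)" for n
    by (cases "even n") simp_all
  ultimately show ?thesis by (simp only:)
qed

text \<open>The row bound gives |u e| < 1 for every eigenvalue e, so the series splits into finitely
  many logarithm series. The branch of \<open>Ln\<close> is harmless because the exponential is
  applied at once.\<close>

lemma det_eq_exp_trace_series:
  fixes A :: "complex mat"
  assumes A: "A \<in> carrier_mat n n"
    and row: "\<And>i. i < n \<Longrightarrow> (\<Sum>j<n. norm (A $$ (i, j))) \<le> c"
    and u: "norm u * c < 1"
  shows "exp (- (\<Sum>k. u ^ Suc k / of_nat (Suc k) * mat_trace (A ^\<^sub>m Suc k))) = det (1\<^sub>m n - u \<cdot>\<^sub>m A)"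
proof -
  obtain es where es: "length es = n" "\<And>e. e \<in> set es \<Longrightarrow> eigenvalue A e"
    "\<And>k. mat_trace (A ^\<^sub>m k) = (\<Sum>e\<leftarrow>es. e ^ k)"
    "\<And>u. det (1\<^sub>m n - u \<cdot>\<^sub>m A) = (\<Prod>e\<leftarrow>es. 1 - u * e)"
    using mat_spectrum[OF A] by metis
  have small: "norm (u * e) < 1" if "e \<in> set es" for e
  proof -
    have "norm (u * e) \<le> norm u * c"
      unfolding norm_mult
      using eigenvalue_norm_le_row_sum[OF A es(2)[OF that] row] by (intro mult_left_mono) auto
    then show ?thesis using u by simp
  qed
  have "(\<lambda>k. \<Sum>i<n. (u * es ! i) ^ Suc k / of_nat (Suc k)) sums (\<Sum>i<n. - Ln (1 - u * es ! i))"
    using small es(1) by (intro sums_sum sums_minus_Ln_one_minus) auto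
  moreover have "(\<Sum>i<n. (u * es ! i) ^ Suc k / of_nat (Suc k)) =
      u ^ Suc k / of_nat (Suc k) * mat_trace (A ^\<^sub>m Suc k)" for k
    unfolding es(3) using es(1)
    by (simp add: sum_list_sum_nth atLeast0LessThan sum_distrib_left power_mult_distrib
        sum_divide_distrib mult_ac)
  ultimately have "(\<Sum>k. u ^ Suc k / of_nat (Suc k) * mat_trace (A ^\<^sub>m Suc k)) =
      (\<Sum>i<n. - Ln (1 - u * es ! i))"
    by (simp add: sums_iff)
  then have "exp (- (\<Sum>k. u ^ Suc k / of_nat (Suc k) * mat_trace (A ^\<^sub>m Suc k))) =
      (\<Prod>i<n. exp (Ln (1 - u * es ! i)))"
    by (simp add: sum_negf exp_sum)
  also have "\<dots> = (\<Prod>i<n. 1 - u * es ! i)"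
  proof (intro prod.cong refl)
    fix i assume "i \<in> {..<n}"
    then have "u * es ! i \<noteq> 1" using small[of "es ! i"] es(1) by force
    then show "exp (Ln (1 - u * es ! i)) = 1 - u * es ! i" by simp
  qed
  also have "\<dots> = det (1\<^sub>m n - u \<cdot>\<^sub>m A)"
    unfolding es(4) using es(1) by (simp add: prod.list_conv_set_nth atLeast0LessThan)
  finally show ?thesis .
qed

section \<open>Periodic sequences and primitive closed paths\<close>

text \<open>Read periodically, a closed path has no distinguished end: the condition at the closing
  edge becomes one of the conditions on consecutive edges, and rotations and powers become
  statements about a sequence on the naturals.\<close>

definition cyc :: "'a list \<Rightarrow> nat \<Rightarrow> 'a" where
  "cyc p i = p ! (i mod length p)"

definition is_period :: "(nat \<Rightarrow> 'a) \<Rightarrow> nat \<Rightarrow> bool" where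
  "is_period e n \<longleftrightarrow> n > 0 \<and> (\<forall>i. e (i + n) = e i)"

definition min_period :: "(nat \<Rightarrow> 'a) \<Rightarrow> nat" where
  "min_period e = (LEAST n. is_period e n)"

lemma is_period_cyc: "p \<noteq> [] \<Longrightarrow> is_period (cyc p) (length p)"
  by (simp add: is_period_def cyc_def)

lemma is_period_add_mult: "is_period e n \<Longrightarrow> e (i + k * n) = e i"
proof (induction k)
  case (Suc k)
  then have "e (i + k * n + n) = e i" by (simp add: is_period_def)
  then show ?case by (simp add: algebra_simps)
qed simp

lemma is_period_mod: "is_period e n \<Longrightarrow> e (i mod n) = e i"
  using is_period_add_mult[of e n "i mod n" "i div n"] by simp

text \<open>If the least period did not divide n, the remainder of n would be a smaller positive
  period.\<close>

lemma min_period_props: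
  assumes "is_period e n"
  shows "is_period e (min_period e)" "min_period e dvd n"
proof -
  let ?d = "min_period e"
  show d: "is_period e ?d"
    unfolding min_period_def using assms by (rule LeastI)
  show "?d dvd n"
  proof (rule ccontr)
    assume "\<not> ?d dvd n"
    then have "n mod ?d > 0" by (simp add: dvd_eq_mod_eq_0)
    moreover have "e (i + n mod ?d) = e i" for i
    proof -
      have "e (i + n mod ?d) = e (i + n mod ?d + n div ?d * ?d)"
        by (rule is_period_add_mult[OF d, symmetric])
      also have "\<dots> = e (i + n)" by (simp add: add.assoc)
      finally show ?thesis using assms by (simp add: is_period_def)
    qed
    ultimately have "is_period e (n mod ?d)" by (simp add: is_period_def)
    then have "?d \<le> n mod ?d" unfolding min_period_def by (rule Least_le)
    moreover have "n mod ?d < ?d" using d by (simp add: is_period_def)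
    ultimately show False by simp
  qed
qed

lemma min_period_le: "is_period e n \<Longrightarrow> min_period e \<le> n"
  unfolding min_period_def by (rule Least_le)

lemma cyc_eqI:
  assumes "length p = length p'" "\<And>i. i < length p \<Longrightarrow> cyc p i = cyc p' i"
  shows "p = p'"
  using assms by (intro nth_equalityI) (auto simp: cyc_def)

lemma length_concat_replicate: "length (concat (replicate k r)) = k * length r"
  by (induction k) auto

lemma nth_concat_replicate:
  "i < k * length r \<Longrightarrow> concat (replicate k r) ! i = r ! (i mod length r)"
proof (induction k arbitrary: i)
  case (Suc k)
  show ?case
  proof (cases "i < length r")
    case False
    then have "concat (replicate k r) ! (i - length r) = r ! ((i - length r) mod length r)"
      using Suc by auto
    with False show ?thesis by (simp add: nth_append le_mod_geq)
  qed (simp add: nth_append)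
qed simp

lemma cyc_concat_replicate:
  assumes "k > 0" "r \<noteq> []"
  shows "cyc (concat (replicate k r)) = cyc r"
proof
  fix i
  have "i mod (k * length r) < k * length r" using assms by simp
  then show "cyc (concat (replicate k r)) i = cyc r i"
    by (simp add: cyc_def length_concat_replicate nth_concat_replicate mod_mod_cancel)
qed

lemma concat_replicate_root:
  assumes "p \<noteq> []" "is_period (cyc p) d" "d dvd length p"
  shows "cyc (take d p) = cyc p" "concat (replicate (length p div d) (take d p)) = p"
proof -
  have d: "d > 0" "d \<le> length p"
    using assms by (auto simp: is_period_def dvd_imp_le)
  show eq: "cyc (take d p) = cyc p"
  proof
    fix i
    have "i mod d < d" "i mod d < length p" using d by (simp_all add: less_le_trans[OF mod_less_divisor])
    then have "cyc (take d p) i = cyc p (i mod d)"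
      using d by (simp add: cyc_def min_def)
    then show "cyc (take d p) i = cyc p i"
      using is_period_mod[OF assms(2)] by simp
  qed
  show "concat (replicate (length p div d) (take d p)) = p"
  proof (rule cyc_eqI)
    show "length (concat (replicate (length p div d) (take d p))) = length p"
      using d assms(3) by (simp add: length_concat_replicate min_def)
    have "length p div d > 0" using d by (simp add: div_greater_zero_iff)
    moreover have "take d p \<noteq> []" using d by auto
    ultimately show "cyc (concat (replicate (length p div d) (take d p))) i = cyc p i" for i
      using cyc_concat_replicate eq by metis
  qed
qed

lemma cyc_rotate: "p \<noteq> [] \<Longrightarrow> cyc (rotate j p) i = cyc p (i + j)"
  by (simp add: cyc_def nth_rotate add.commute mod_add_right_eq)

text \<open>Rotation cannot increase the least period, and it can be undone by a further rotation,
  so one inequality gives both.\<close>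

lemma min_period_cyc_rotate:
  assumes "p \<noteq> []"
  shows "min_period (cyc (rotate j p)) = min_period (cyc p)"
proof -
  have le: "min_period (cyc (rotate j r)) \<le> min_period (cyc r)" if "r \<noteq> []" for j and r :: "'a list"
  proof (rule min_period_le)
    have "is_period (cyc r) (min_period (cyc r))"
      using min_period_props(1)[OF is_period_cyc[OF that]] .
    then show "is_period (cyc (rotate j r)) (min_period (cyc r))"
      by (auto simp: is_period_def cyc_rotate[OF that] add.assoc add.commute[of _ j])
        (metis add.assoc)
  qed
  \<comment> \<open>Rotating on to a total of \<open>length p * j\<close> steps returns to
    \<open>p\<close>; the subtraction does not truncate because \<open>p\<close> is
    nonempty.\<close>
  have "rotate (length p * j - j) (rotate j p) = rotate (length p * j) p"
    using assms by (simp add: rotate_rotate Suc_leI)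
  also have "\<dots> = p" by (simp add: rotate_id)
  finally show ?thesis
    using le[OF assms, of j] le[of "rotate j p" "length p * j - j"] assms by simp
qed

lemma sum_lessThan_add:
  "sum F {..<a + b} = sum F {..<a} + (\<Sum>i<b. F (a + i))" for F :: "nat \<Rightarrow> 'a :: comm_monoid_add"
  by (induction b) (auto simp: add.assoc)

text \<open>The sum over the first n + j indices is split in two ways, after the first j and after
  the first n terms; by periodicity the sum of the first j terms occurs on both sides and
  cancels.\<close>

lemma sum_is_period_shift:
  fixes F :: "nat \<Rightarrow> 'a :: ab_group_add"
  assumes "is_period F n"
  shows "(\<Sum>k<n. F (k + j)) = sum F {..<n}"
proof -
  have "sum F {..<j} + (\<Sum>k<n. F (j + k)) = sum F {..<n} + (\<Sum>k<j. F (n + k))"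
    using sum_lessThan_add[of F j n] sum_lessThan_add[of F n j] by (simp add: add.commute)
  also have "(\<Sum>k<j. F (n + k)) = sum F {..<j}"
    using assms by (simp add: is_period_def add.commute)
  finally show ?thesis by (simp add: add.commute)
qed

lemma sum_is_period_mult:
  fixes F :: "nat \<Rightarrow> 'a :: {comm_ring_1}"
  assumes "is_period F n"
  shows "sum F {..<k * n} = of_nat k * sum F {..<n}"
proof (induction k)
  case (Suc k)
  have "sum F {..<k * n + n} = sum F {..<k * n} + (\<Sum>i<n. F (k * n + i))"
    by (rule sum_lessThan_add)
  also have "(\<Sum>i<n. F (k * n + i)) = sum F {..<n}"
    using is_period_add_mult[OF assms, of _ k] by (simp add: add.commute)
  finally show ?case using Suc by (simp add: algebra_simps)
qed simp

text \<open>The bound 3 on the length is absorbed here: a cyclic admissible sequence of length 1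
  would be a loop, and in one of length 2 the second edge would be the reversal of the first. This
  makes the trace formula exact for every exponent.\<close>

lemma closed_path_iff:
  assumes "pair_graph G"
  shows "closed_path G p \<longleftrightarrow>
    p \<noteq> [] \<and> (\<forall>i. cyc p i \<in> parcs G \<and> admissible (cyc p i) (cyc p (Suc i)))"
proof (intro iffI conjI allI)
  assume *: "closed_path G p"
  then show ne: "p \<noteq> []" by (auto simp: closed_path_def)
  fix i
  have lt: "i mod length p < length p" using ne by simp
  then show "cyc p i \<in> parcs G"
    using * by (auto simp: closed_path_def cyc_def)
  show "admissible (cyc p i) (cyc p (Suc i))"
  proof (cases "Suc (i mod length p) = length p")
    case True
    then have "i mod length p = length p - 1" by simp
    moreover have "Suc i mod length p = 0" using True by (simp add: mod_Suc)
    ultimately have "cyc p i = last p" "cyc p (Suc i) = hd p"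
      using ne by (simp_all add: cyc_def last_conv_nth hd_conv_nth)
    then show ?thesis using * by (auto simp: closed_path_def admissible_def)
  next
    case False
    then show ?thesis using * lt by (auto simp: closed_path_def cyc_def mod_Suc)
  qed
next
  interpret pair_graph G by fact
  assume *: "p \<noteq> [] \<and> (\<forall>i. cyc p i \<in> parcs G \<and> admissible (cyc p i) (cyc p (Suc i)))"
  then have ne: "p \<noteq> []" and arc: "\<And>i. cyc p i \<in> parcs G"
    and adm: "\<And>i. admissible (cyc p i) (cyc p (Suc i))" by auto
  have "length p \<noteq> 1"
  proof
    assume "length p = 1"
    then have "snd (p ! 0) = fst (p ! 0)" using adm[of 0] by (simp add: cyc_def admissible_def)
    moreover have "p ! 0 \<in> parcs G" using arc[of 0] by (simp add: cyc_def)
    ultimately show False using pair_no_loops by metis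
  qed
  moreover have "length p \<noteq> 2"
  proof
    assume "length p = 2"
    then show False using adm[of 0] adm[of 1]
      by (auto simp: cyc_def admissible_def prod_eq_iff)
  qed
  moreover have "length p \<noteq> 0" using ne by simp
  ultimately have "3 \<le> length p" by linarith
  moreover have "set p \<subseteq> parcs G"
  proof
    fix x assume "x \<in> set p"
    then obtain i where "i < length p" "p ! i = x" by (auto simp: in_set_conv_nth)
    then show "x \<in> parcs G" using arc[of i] by (simp add: cyc_def)
  qed
  moreover have "admissible (p ! i) (p ! Suc i)" if "Suc i < length p" for i
    using adm[of i] that by (simp add: cyc_def)
  moreover have "admissible (last p) (hd p)"
    using adm[of "length p - 1"] ne by (simp add: cyc_def last_conv_nth hd_conv_nth)
  ultimately show "closed_path G p"
    by (auto simp: closed_path_def admissible_def)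
qed

lemma closed_path_cyc_cong:
  assumes "pair_graph G" "p \<noteq> []" "p' \<noteq> []" "cyc p = cyc p'"
  shows "closed_path G p \<longleftrightarrow> closed_path G p'"
  using assms by (simp add: closed_path_iff)

lemma closed_path_rotate:
  assumes "pair_graph G" "closed_path G p"
  shows "closed_path G (rotate j p)"
  using assms by (auto simp: closed_path_iff cyc_rotate simp del: rotate_Suc)

text \<open>The prefix of length the least period has the same periodic extension as the path, so it
  is automatically a closed path and the given path is a power of it. Primitivity thus forces the
  prefix to be everything.\<close>

lemma primitive_path_iff:
  assumes "pair_graph G"
  shows "primitive_path G p \<longleftrightarrow> closed_path G p \<and> min_period (cyc p) = length p"
proof (intro iffI conjI)
  assume *: "primitive_path G p"
  then show cl: "closed_path G p" by (simp add: primitive_path_def)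
  then have ne: "p \<noteq> []" by (auto simp: closed_path_def)
  let ?d = "min_period (cyc p)"
  note d = min_period_props[OF is_period_cyc[OF ne]]
  note root = concat_replicate_root[OF ne d]
  have "?d \<le> length p" using d(2) ne by (simp add: dvd_imp_le)
  moreover have "closed_path G (take ?d p)"
  proof -
    have "take ?d p \<noteq> []" using ne d(1) by (simp add: is_period_def)
    then show ?thesis using closed_path_cyc_cong[OF assms _ ne root(1)] cl by simp
  qed
  ultimately show "?d = length p"
    using * root(2) unfolding primitive_path_def
    by (metis length_take linorder_not_le min.absorb2 order_antisym)
next
  assume *: "closed_path G p \<and> min_period (cyc p) = length p"
  then have ne: "p \<noteq> []" by (auto simp: closed_path_def)
  have False if "closed_path G r" "length r < length p" "p = concat (replicate m r)" for r m
  proof -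
    have "m > 0" using that(3) ne by (cases m) auto
    moreover have r: "r \<noteq> []" using that by (auto simp: closed_path_def)
    ultimately have "is_period (cyc p) (length r)"
      using cyc_concat_replicate is_period_cyc that(3) by metis
    then show False using min_period_le * that(2) by fastforce
  qed
  then show "primitive_path G p" using * by (auto simp: primitive_path_def)
qed

lemma primitive_path_rotate:
  assumes "pair_graph G" "primitive_path G p"
  shows "primitive_path G (rotate j p)"
proof -
  have "p \<noteq> []" using assms(2) by (auto simp: primitive_path_def closed_path_def)
  then show ?thesis
    using assms closed_path_rotate by (auto simp: primitive_path_iff min_period_cyc_rotate)
qed

text \<open>A power of a primitive \<open>r\<close> has the same periodic extension as
  \<open>r\<close>, whose least period is \<open>length r\<close>. The root and the exponent are
  therefore recovered from the least period alone.\<close>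

lemma bij_betw_powers_closed_paths:
  assumes "pair_graph G"
  shows "bij_betw (\<lambda>(k, r). concat (replicate k r)) ({1..} \<times> {r. primitive_path G r})
           {p. closed_path G p}"
proof (rule bij_betwI[where
      g = "\<lambda>p. (length p div min_period (cyc p), take (min_period (cyc p)) p)"])
  have "(length (concat (replicate k r)) div min_period (cyc (concat (replicate k r))),
      take (min_period (cyc (concat (replicate k r)))) (concat (replicate k r))) = (k, r)"
    if kr: "k \<ge> 1" "primitive_path G r" for k r
  proof -
    have ne: "r \<noteq> []" and mp: "min_period (cyc r) = length r"
      using kr(2) assms by (auto simp: primitive_path_iff closed_path_def)
    have cyc: "cyc (concat (replicate k r)) = cyc r"
      using kr ne by (intro cyc_concat_replicate) auto
    have "take (length r) (concat (replicate k r)) = r"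
      using kr(1) by (cases k) auto
    then show ?thesis
      using ne by (simp add: cyc mp length_concat_replicate)
  qed
  then show "(\<lambda>p. (length p div min_period (cyc p), take (min_period (cyc p)) p))
      ((\<lambda>(k, r). concat (replicate k r)) a) = a"
    if "a \<in> {1..} \<times> {r. primitive_path G r}" for a
    using that by (cases a) auto
  have root: "concat (replicate (length p div min_period (cyc p)) (take (min_period (cyc p)) p)) = p
      \<and> 1 \<le> length p div min_period (cyc p) \<and> primitive_path G (take (min_period (cyc p)) p)"
    if "closed_path G p" for p
  proof -
    have ne: "p \<noteq> []" using that by (auto simp: closed_path_def)
    let ?d = "min_period (cyc p)"
    note d = min_period_props[OF is_period_cyc[OF ne]]
    note root = concat_replicate_root[OF ne d]
    have le: "?d \<le> length p" "?d > 0" using d ne by (auto simp: dvd_imp_le is_period_def)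
    then have "take ?d p \<noteq> []" using ne by simp
    then have "closed_path G (take ?d p)"
      using closed_path_cyc_cong[OF assms _ ne root(1)] that by simp
    then have "primitive_path G (take ?d p)"
      using le by (simp add: primitive_path_iff[OF assms] root(1))
    moreover have "1 \<le> length p div ?d"
      using le div_greater_zero_iff[of "length p" ?d] by linarith
    ultimately show ?thesis using root(2) by simp
  qed
  then show "(\<lambda>(k, r). concat (replicate k r))
      (length p div min_period (cyc p), take (min_period (cyc p)) p) = p"
    if "p \<in> {p. closed_path G p}" for p
    using that by auto
  show "(\<lambda>p. (length p div min_period (cyc p), take (min_period (cyc p)) p))
      \<in> {p. closed_path G p} \<rightarrow> {1..} \<times> {r. primitive_path G r}"
    using root by auto
  have "closed_path G (concat (replicate k r))" if "k \<ge> 1" "primitive_path G r" for k r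
  proof -
    have "r \<noteq> []" "closed_path G r" using that(2) by (auto simp: primitive_path_def closed_path_def)
    moreover from this have "concat (replicate k r) \<noteq> []" using that(1) by (cases k) auto
    ultimately show ?thesis
      using closed_path_cyc_cong[OF assms, of "concat (replicate k r)" r] cyc_concat_replicate[of k r] that(1)
      by simp
  qed
  then show "(\<lambda>(k, r). concat (replicate k r)) \<in> {1..} \<times> {r. primitive_path G r} \<rightarrow> {p. closed_path G p}"
    by auto
qed

section \<open>Rotation classes of primitive paths\<close>

abbreviation rotation_rel :: "'v pair_pre_digraph \<Rightarrow> (('v \<times> 'v) list \<times> ('v \<times> 'v) list) set" where
  "rotation_rel G \<equiv>
     {(p, p'). primitive_path G p \<and> primitive_path G p' \<and> (\<exists>n. p' = rotate n p)}"

lemma equiv_rotation_rel: "equiv {p. primitive_path G p} (rotation_rel G)"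
proof (rule equivI)
  show "refl_on {p. primitive_path G p} (rotation_rel G)"
    by (auto simp: refl_on_def intro: exI[of _ 0])
  have "\<exists>m. p = rotate m (rotate n p)" if "p \<noteq> []" for n and p :: "('a \<times> 'a) list"
  proof
    have "rotate (length p * n - n) (rotate n p) = rotate (length p * n) p"
      using that by (simp add: rotate_rotate Suc_leI)
    then show "p = rotate (length p * n - n) (rotate n p)" by (simp add: rotate_id)
  qed
  then show "sym (rotation_rel G)"
    by (auto simp: sym_def primitive_path_def closed_path_def)
      (metis list.size(3) not_numeral_le_zero)
  show "trans (rotation_rel G)"
    by (auto simp: trans_def rotate_rotate)
qed auto

lemma primitive_class_eq:
  assumes "c \<in> primitive_classes G" "r \<in> c"
  shows "primitive_path G r" "c = rotation_rel G `` {r}"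
proof -
  obtain r0 where r0: "primitive_path G r0" "c = rotation_rel G `` {r0}"
    using assms(1) by (auto simp: primitive_classes_def quotient_def)
  then have rel: "(r0, r) \<in> rotation_rel G" using assms(2) by auto
  then show "primitive_path G r" by auto
  show "c = rotation_rel G `` {r}"
    unfolding r0(2) by (rule equiv_class_eq[OF equiv_rotation_rel rel])
qed

text \<open>Two equal rotations by i < j < \<open>length r\<close> would make j - i a period smaller
  than the least one. Primitivity thus ensures that a class has as many members as its paths have
  edges.\<close>

lemma primitive_class_image:
  assumes "pair_graph G" "c \<in> primitive_classes G" "r \<in> c"
  shows "c = (\<lambda>j. rotate j r) ` {..<length r}" "inj_on (\<lambda>j. rotate j r) {..<length r}"
proof -
  note r = primitive_class_eq[OF assms(2,3)]
  have ne: "r \<noteq> []" and mp: "min_period (cyc r) = length r"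
    using r(1) assms(1) by (auto simp: primitive_path_iff closed_path_def)
  have "rotate n r = rotate (n mod length r) r" for n by (rule rotate_conv_mod)
  moreover have "n mod length r < length r" for n using ne by simp
  ultimately have "\<exists>j<length r. rotate n r = rotate j r" for n by metis
  then show "c = (\<lambda>j. rotate j r) ` {..<length r}"
    using primitive_path_rotate[OF assms(1) r(1)] r by auto
  have False if "i < j" "j < length r" "rotate i r = rotate j r" for i j
  proof -
    have shifted: "cyc r (x + i) = cyc r (x + j)" for x
      using that(3) cyc_rotate[OF ne] by metis
    have "is_period (cyc r) (j - i)"
      unfolding is_period_def
    proof (intro conjI allI)
      fix x
      \<comment> \<open>Only shifts by adding are available on the naturals, so \<open>i\<close>
        whole periods are added to make room for going back by \<open>i\<close>.\<close>
      have "cyc r (x + (j - i)) = cyc r (x + (j - i) + i * length r)"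
        by (rule is_period_add_mult[OF is_period_cyc[OF ne], symmetric])
      also have "x + (j - i) + i * length r = x + (i * length r - i) + j"
        using \<open>i < j\<close> ne by (cases r) (auto simp: algebra_simps)
      also have "cyc r (x + (i * length r - i) + j) = cyc r (x + (i * length r - i) + i)"
        by (rule shifted[symmetric])
      also have "x + (i * length r - i) + i = x + i * length r"
        using ne by (cases r) auto
      also have "cyc r (x + i * length r) = cyc r x"
        by (rule is_period_add_mult[OF is_period_cyc[OF ne]])
      finally show "cyc r (x + (j - i)) = cyc r x" .
    qed (use that in simp)
    then show False using min_period_le[of "cyc r" "j - i"] that mp by simp
  qed
  then show "inj_on (\<lambda>j. rotate j r) {..<length r}"
    by (intro linorder_inj_onI) auto
qed

section \<open>Weights along periodic chains\<close>

lemma shift_periodic_chain: "p \<noteq> [] \<Longrightarrow> shift (periodic_chain p) = periodic_chain (rotate1 p)"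
proof -
  assume ne: "p \<noteq> []"
  have "case_nat (p ! 0) (\<lambda>i. p ! (length p - 1 - i mod length p)) =
      (\<lambda>i. rotate1 p ! (length p - 1 - i mod length p))"
  proof
    fix i
    show "case_nat (p ! 0) (\<lambda>i. p ! (length p - 1 - i mod length p)) i =
        rotate1 p ! (length p - 1 - i mod length p)"
    \<comment> \<open>At 0 stands the edge just passed, the first of \<open>p\<close>, which
      \<open>rotate1\<close> moves to the end; the other backward edges move one place further
      away.\<close>
    proof (cases i)
      case 0
      then show ?thesis using ne by (simp add: nth_rotate1)
    next
      case (Suc j)
      have lt: "j mod length p < length p" using ne by simp
      show ?thesis
      proof (cases "Suc (j mod length p) = length p")
        case False
        then have "Suc (length p - Suc (Suc (j mod length p))) = length p - Suc (j mod length p)"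
          using lt by linarith
        then show ?thesis using ne Suc lt False by (simp add: nth_rotate1 mod_Suc)
      qed (use ne Suc in \<open>auto simp: nth_rotate1 mod_Suc\<close>)
    qed
  qed
  moreover have "p ! (Suc i mod length p) = rotate1 p ! (i mod length p)" for i
    using ne by (simp add: nth_rotate1 mod_Suc_eq)
  ultimately show ?thesis
    unfolding shift_def periodic_chain_def by (simp only: prod.case mod_0 length_rotate1)
qed

lemma shift_pow_periodic_chain:
  "p \<noteq> [] \<Longrightarrow> (shift ^^ k) (periodic_chain p) = periodic_chain (rotate k p)"
  by (induction k) (auto simp: shift_periodic_chain)

text \<open>The delicate half is the backward one. Its i-th edge is the edge of the periodic
  extension at position K * n - 1 - i, for any K large enough to avoid truncation
  (\<open>rev_nth\<close>); the multiples of the two lengths are chosen so that both lists are read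
  at the same position.\<close>

lemma periodic_chain_concat_replicate:
  assumes "k > 0" "r \<noteq> []"
  shows "periodic_chain (concat (replicate k r)) = periodic_chain r"
proof -
  have rev_nth: "p ! (length p - 1 - i mod length p) = cyc p (K * length p - 1 - i)"
    if "i < K * length p" for p :: "('a \<times> 'a) list" and i K
  proof -
    let ?n = "length p"
    have n: "?n > 0" using that by (cases p) auto
    have lt: "i mod ?n < ?n" using n by simp
    have K: "i div ?n < K" using that by (simp add: less_mult_imp_div_less)
    then obtain m where m: "K = Suc (i div ?n + m)" using less_iff_Suc_add by auto
    have "K * ?n = i div ?n * ?n + m * ?n + ?n" unfolding m by (simp add: algebra_simps)
    then have "K * ?n - 1 - i = m * ?n + (?n - 1 - i mod ?n)"
      using div_mult_mod_eq[of i ?n] lt by linarith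
    moreover have "(m * ?n + (?n - 1 - i mod ?n)) mod ?n = ?n - 1 - i mod ?n"
      using n by simp
    ultimately show ?thesis by (simp add: cyc_def)
  qed
  let ?p = "concat (replicate k r)"
  note cyc = cyc_concat_replicate[OF assms]
  have "?p ! (length ?p - 1 - i mod length ?p) = r ! (length r - 1 - i mod length r)" for i
  proof -
    have lt: "i < Suc i * (k * length r)" using assms by (cases k; cases r) auto
    have "?p ! (length ?p - 1 - i mod length ?p) = cyc ?p (Suc i * length ?p - 1 - i)"
      by (rule rev_nth) (use lt in \<open>simp only: length_concat_replicate\<close>)
    moreover have "r ! (length r - 1 - i mod length r) = cyc r (Suc i * k * length r - 1 - i)"
      by (rule rev_nth) (use lt in \<open>simp only: mult.assoc\<close>)
    ultimately show ?thesis by (simp only: length_concat_replicate cyc mult.assoc)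
  qed
  moreover have "?p ! (i mod length ?p) = r ! (i mod length r)" for i
    using fun_cong[OF cyc, of i] by (simp add: cyc_def)
  ultimately show ?thesis by (simp add: periodic_chain_def)
qed

text \<open>Unlike \<open>class_weight\<close> this needs no representative and applies to
  imprimitive paths too, which is what the trace formula sums over.\<close>

definition path_weight :: "('v chain \<Rightarrow> complex) \<Rightarrow> ('v \<times> 'v) list \<Rightarrow> complex" where
  "path_weight f p = (\<Sum>k<length p. f ((shift ^^ k) (periodic_chain p)))"

lemma is_period_shift_periodic_chain:
  "p \<noteq> [] \<Longrightarrow> is_period (\<lambda>k. f ((shift ^^ k) (periodic_chain p))) (length p)"
  unfolding is_period_def
proof (intro conjI allI)
  fix i assume "p \<noteq> []"
  moreover have "rotate (i + length p) p = rotate i p"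
    using rotate_conv_mod[of "i + length p" p] rotate_conv_mod[of i p] by (simp only: mod_add_self2)
  ultimately show "f ((shift ^^ (i + length p)) (periodic_chain p)) = f ((shift ^^ i) (periodic_chain p))"
    by (simp add: shift_pow_periodic_chain)
qed simp

lemma path_weight_rotate:
  assumes "p \<noteq> []"
  shows "path_weight f (rotate j p) = path_weight f p"
proof -
  have "path_weight f (rotate j p) = (\<Sum>k<length p. f ((shift ^^ (k + j)) (periodic_chain p)))"
    using assms by (simp add: path_weight_def shift_pow_periodic_chain rotate_rotate)
  also have "\<dots> = path_weight f p"
    unfolding path_weight_def
    using sum_is_period_shift[OF is_period_shift_periodic_chain[OF assms]] .
  finally show ?thesis .
qed

lemma path_weight_concat_replicate:
  assumes "k > 0" "r \<noteq> []"
  shows "path_weight f (concat (replicate k r)) = of_nat k * path_weight f r"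
  unfolding path_weight_def periodic_chain_concat_replicate[OF assms] length_concat_replicate
  by (rule sum_is_period_mult[OF is_period_shift_periodic_chain[OF assms(2)]])

lemma class_length_eq:
  assumes "pair_graph G" "c \<in> primitive_classes G" "r \<in> c"
  shows "class_length c = length r" "class_weight f c = path_weight f r" "card c = length r"
    "finite c" "length r > 0"
proof -
  have ne: "r \<noteq> []"
    using primitive_class_eq(1)[OF assms(2,3)] by (auto simp: primitive_path_def closed_path_def)
  then show "length r > 0" by simp
  note im = primitive_class_image[OF assms]
  have "(SOME p. p \<in> c) \<in> c" using assms(3) by (rule someI)
  then obtain j where "(SOME p. p \<in> c) = rotate j r" using im(1) by auto
  then show "class_length c = length r" "class_weight f c = path_weight f r"
    using path_weight_rotate[OF ne, of f j] by (simp_all add: class_length_def class_weight_def path_weight_def)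
  show "card c = length r" "finite c" using im by (metis card_image card_lessThan, metis finite_imageI finite_lessThan)
qed

lemma primitive_class_nonempty:
  assumes "c \<in> primitive_classes G"
  obtains r where "r \<in> c"
proof -
  have "c \<noteq> {}"
    using in_quotient_imp_non_empty[OF equiv_rotation_rel] assms unfolding primitive_classes_def .
  then show ?thesis using that by blast
qed

lemma bij_betw_Sigma_primitive_classes:
  "bij_betw (\<lambda>((k, c), r). (k, r)) (Sigma (K \<times> primitive_classes G) (\<lambda>(k, c). c))
     (K \<times> {r. primitive_path G r})"
proof (rule bij_betw_byWitness[where f' = "\<lambda>(k, r). ((k, rotation_rel G `` {r}), r)"])
  show "\<forall>a\<in>Sigma (K \<times> primitive_classes G) (\<lambda>(k, c). c).
      (\<lambda>(k, r). ((k, rotation_rel G `` {r}), r)) ((\<lambda>((k, c), r). (k, r)) a) = a"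
    using primitive_class_eq(2) by (auto simp del: Image_singleton)
  show "(\<lambda>((k, c), r). (k, r)) ` Sigma (K \<times> primitive_classes G) (\<lambda>(k, c). c)
      \<subseteq> K \<times> {r. primitive_path G r}"
    using primitive_class_eq(1) by auto
  show "(\<lambda>(k, r). ((k, rotation_rel G `` {r}), r)) ` (K \<times> {r. primitive_path G r})
      \<subseteq> Sigma (K \<times> primitive_classes G) (\<lambda>(k, c). c)"
  proof (rule image_subsetI)
    fix a assume "a \<in> K \<times> {r. primitive_path G r}"
    then obtain k r where a: "a = (k, r)" "k \<in> K" "primitive_path G r" by auto
    then have "rotation_rel G `` {r} \<in> primitive_classes G"
      unfolding primitive_classes_def by (intro quotientI) simp
    moreover have "r \<in> rotation_rel G `` {r}"
      using a(3) equiv_class_self[OF equiv_rotation_rel] by blast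
    ultimately show "(\<lambda>(k, r). ((k, rotation_rel G `` {r}), r)) a \<in> Sigma (K \<times> primitive_classes G) (\<lambda>(k, c). c)"
      unfolding a(1) prod.case using a(2) by (intro SigmaI) simp_all
  qed
qed auto

text \<open>Triples (k, c, r) with r in the class c correspond bijectively to closed paths, namely
  to the k-th power of r. The hypothesis on \<open>a\<close> says that all members of c contribute
  the same amount, so the inner sum over c is \<open>length r\<close> times one value. Both the
  determinant and the zeta series are instances.\<close>

lemma infsum_primitive_classes:
  fixes h :: "('v \<times> 'v) list \<Rightarrow> complex" and a :: "nat \<Rightarrow> ('v \<times> 'v) list set \<Rightarrow> complex"
  assumes G: "pair_graph G" and h: "h summable_on {p. closed_path G p}"
    and a: "\<And>k c r. k \<ge> 1 \<Longrightarrow> c \<in> primitive_classes G \<Longrightarrow> r \<in> c \<Longrightarrow>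
      of_nat (length r) * h (concat (replicate k r)) = a k c"
  shows "(\<lambda>(k, c). a k c) summable_on {1..} \<times> primitive_classes G"
    and "infsum (\<lambda>(k, c). a k c) ({1..} \<times> primitive_classes G) = infsum h {p. closed_path G p}"
proof -
  let ?A = "{1::nat..} \<times> primitive_classes G"
  let ?S = "Sigma ?A (\<lambda>(k, c). c)"
  let ?H = "\<lambda>((k::nat, c::('v \<times> 'v) list set), r). h (concat (replicate k r))"
  have bij: "bij_betw ((\<lambda>(k, r). concat (replicate k r)) \<circ> (\<lambda>((k, c), r). (k, r))) ?S {p. closed_path G p}"
    by (rule bij_betw_trans[OF bij_betw_Sigma_primitive_classes bij_betw_powers_closed_paths[OF G]])
  have H: "?H = (\<lambda>x. h (((\<lambda>(k, r). concat (replicate k r)) \<circ> (\<lambda>((k, c), r). (k, r))) x))"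
    by (auto simp: fun_eq_iff)
  have "(?H has_sum infsum h {p. closed_path G p}) ?S"
    unfolding H has_sum_reindex_bij_betw[OF bij] using h by (rule has_sum_infsum)
  moreover have "((\<lambda>r. ?H (x, r)) has_sum (\<lambda>(k, c). a k c) x) ((\<lambda>(k, c). c) x)" if x: "x \<in> ?A" for x
  proof -
    obtain k c where [simp]: "x = (k, c)" by (cases x)
    have kc: "k \<ge> 1" "c \<in> primitive_classes G" using x by auto
    obtain r where r: "r \<in> c" using primitive_class_nonempty[OF kc(2)] .
    note len = class_length_eq[OF G kc(2)]
    \<comment> \<open>All members of \<open>c\<close> have the length \<open>card c\<close>, so the
      division by \<open>length r\<close> does not depend on \<open>p\<close>.\<close>
    have "h (concat (replicate k p)) = a k c / of_nat (length r)" if "p \<in> c" for p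
      using a[OF kc that] len(3,5)[OF that] len(3)[OF r] by (auto simp: field_simps)
    then have "(\<Sum>p\<in>c. h (concat (replicate k p))) = a k c"
      using len(3,5)[OF r] by simp
    then show ?thesis using has_sum_finite[OF len(4)[OF r], of "\<lambda>p. h (concat (replicate k p))"] by simp
  qed
  ultimately have "((\<lambda>(k, c). a k c) has_sum infsum h {p. closed_path G p}) ?A"
    by (rule has_sum_SigmaD)
  then show "(\<lambda>(k, c). a k c) summable_on ?A"
    "infsum (\<lambda>(k, c). a k c) ?A = infsum h {p. closed_path G p}"
    by (auto simp: summable_on_def infsumI)
qed

section \<open>Finite dependence of locally constant weights\<close>

lemma shift_chains: "x \<in> chains G \<Longrightarrow> shift x \<in> chains G"
  by (auto simp: chains_def shift_def split: nat.split)

lemma shift_pow_chains: "x \<in> chains G \<Longrightarrow> (shift ^^ k) x \<in> chains G"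
  by (induction k) (auto intro: shift_chains)

lemma fst_shift_pow: "fst ((shift ^^ k) x) i = fst x (i + k)"
  by (induction k arbitrary: i) (auto simp: shift_def split: prod.splits)

lemma snd_shift_pow:
  "snd ((shift ^^ k) x) i = (if i < k then fst x (k - 1 - i) else snd x (i - k))"
proof (induction k arbitrary: i)
  case (Suc k)
  have snd_shift: "snd (shift y) i = case_nat (fst y 0) (snd y) i" for y
    by (cases y; cases i) (simp_all add: shift_def)
  show ?case
    unfolding funpow.simps comp_apply snd_shift
    using Suc fst_shift_pow[of k x 0] by (auto split: nat.split)
qed simp

text \<open>The points range over all pairs of edge sequences, not only over chains, so that
  cylinders are open in the ambient product and can also separate a non-chain from the chains. With
  depth 0, \<open>x \<in> cylinder G 0 x\<close> says just that all edges of \<open>x\<close> are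
  arcs.\<close>

definition cylinder :: "'v pair_pre_digraph \<Rightarrow> nat \<Rightarrow> 'v chain \<Rightarrow> 'v chain set" where
  "cylinder G N x = {y. (\<forall>i. fst y i \<in> parcs G \<and> snd y i \<in> parcs G) \<and>
     (\<forall>i<N. fst y i = fst x i \<and> snd y i = snd x i)}"

abbreviation edge_sequences :: "'v pair_pre_digraph \<Rightarrow> (nat \<Rightarrow> 'v \<times> 'v) topology" where
  "edge_sequences G \<equiv> product_topology (\<lambda>_. discrete_topology (parcs G)) UNIV"

lemma openin_cylinder:
  assumes "x \<in> cylinder G 0 x"
  shows "openin (prod_topology (edge_sequences G) (edge_sequences G)) (cylinder G N x)"
proof -
  have op: "openin (edge_sequences G) (\<Pi>\<^sub>E i\<in>UNIV. if i < N then {e i} else parcs G)"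
    if "\<forall>i. e i \<in> parcs G" for e
  proof (rule product_topology_basis)
    show "finite {i. (if i < N then {e i} else parcs G) \<noteq> topspace (discrete_topology (parcs G))}"
      by (rule finite_subset[of _ "{..<N}"]) auto
  qed (use that in auto)
  have "cylinder G N x = (\<Pi>\<^sub>E i\<in>UNIV. if i < N then {fst x i} else parcs G)
      \<times> (\<Pi>\<^sub>E i\<in>UNIV. if i < N then {snd x i} else parcs G)"
  proof (intro equalityI subsetI)
    fix y assume "y \<in> cylinder G N x"
    then show "y \<in> (\<Pi>\<^sub>E i\<in>UNIV. if i < N then {fst x i} else parcs G)
      \<times> (\<Pi>\<^sub>E i\<in>UNIV. if i < N then {snd x i} else parcs G)"
      by (auto simp: cylinder_def mem_Times_iff)
  next
    fix y assume y: "y \<in> (\<Pi>\<^sub>E i\<in>UNIV. if i < N then {fst x i} else parcs G)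
      \<times> (\<Pi>\<^sub>E i\<in>UNIV. if i < N then {snd x i} else parcs G)"
    have "fst y i \<in> (if i < N then {fst x i} else parcs G)"
      "snd y i \<in> (if i < N then {snd x i} else parcs G)" for i
      using y PiE_mem[OF _ UNIV_I, of _ "\<lambda>i. if i < N then {_ i} else parcs G" i]
      unfolding mem_Times_iff by blast+
    moreover have "fst x i \<in> parcs G" "snd x i \<in> parcs G" for i
      using assms by (auto simp: cylinder_def)
    ultimately show "y \<in> cylinder G N x"
      unfolding cylinder_def by (smt (verit) mem_Collect_eq singletonD)
  qed
  then show ?thesis
    using op[of "fst x"] op[of "snd x"] assms by (simp add: openin_prod_Times_iff cylinder_def)
qed

lemma chains_subset: "chains G \<subseteq> topspace (prod_topology (edge_sequences G) (edge_sequences G))"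
  by (auto simp: chains_def)

lemma mem_cylinder_chains: "x \<in> chains G \<Longrightarrow> x \<in> cylinder G N x"
  by (auto simp: chains_def cylinder_def)

text \<open>A failure of admissibility is visible on two neighbouring edges. If it occurs at
  \<open>i\<close>, it involves indices up to i + 1 at most, and the cylinder of depth i + 2
  contains no chain.\<close>

lemma closedin_chains: "closedin (prod_topology (edge_sequences G) (edge_sequences G)) (chains G)"
proof -
  let ?T = "prod_topology (edge_sequences G) (edge_sequences G)"
  have "\<exists>U. openin ?T U \<and> x \<in> U \<and> U \<subseteq> topspace ?T - chains G"
    if x: "x \<in> topspace ?T - chains G" for x
  proof -
    obtain e b where [simp]: "x = (e, b)" by (cases x)
    have arcs: "e i \<in> parcs G" "b i \<in> parcs G" for i
      using x by (auto simp: PiE_UNIV_domain)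
    then have cyl: "x \<in> cylinder G N x" for N by (auto simp: cylinder_def)
    obtain i where i: "\<not> admissible (e i) (e (Suc i)) \<or> \<not> admissible (b (Suc i)) (b i)
        \<or> \<not> admissible (b 0) (e 0)"
      using x arcs by (auto simp: chains_def)
    have "cylinder G (Suc (Suc i)) x \<subseteq> topspace ?T - chains G"
    proof
      fix y assume "y \<in> cylinder G (Suc (Suc i)) x"
      then have y: "\<And>j. fst y j \<in> parcs G" "\<And>j. snd y j \<in> parcs G"
        "\<And>j. j < Suc (Suc i) \<Longrightarrow> fst y j = e j" "\<And>j. j < Suc (Suc i) \<Longrightarrow> snd y j = b j"
        by (auto simp: cylinder_def)
      have "y \<notin> chains G"
      proof
        assume "y \<in> chains G"
        then have "admissible (fst y i) (fst y (Suc i))" "admissible (snd y (Suc i)) (snd y i)"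
          "admissible (snd y 0) (fst y 0)"
          by (auto simp: chains_def)
        then show False using i y(3,4) by simp
      qed
      then show "y \<in> topspace ?T - chains G"
        using y by (cases y) auto
    qed
    then show ?thesis using openin_cylinder[OF cyl] cyl by blast
  qed
  then have "openin ?T (topspace ?T - chains G)"
    by (subst openin_subopen) blast
  then show ?thesis using chains_subset by (auto simp: closedin_def)
qed

lemma compact_space_chain_topology:
  assumes "finite (parcs G)"
  shows "compact_space (chain_topology G)"
proof -
  have "compact_space (edge_sequences G)"
    using assms by (simp add: compact_space_product_topology compact_space_discrete_topology)
  then have "compact_space (prod_topology (edge_sequences G) (edge_sequences G))"
    by (simp add: compact_space_prod_topology)
  then show ?thesis
    unfolding chain_topology_def
    using closedin_chains by (intro compact_space_subtopology closedin_compact_space)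
qed

lemma openin_edge_sequences_cylinder:
  assumes "openin (edge_sequences G) U" "e \<in> U"
  obtains N where "\<And>e'. (\<forall>i. e' i \<in> parcs G) \<Longrightarrow> (\<forall>i<N. e' i = e i) \<Longrightarrow> e' \<in> U"
proof -
  obtain X where X: "e \<in> (\<Pi>\<^sub>E i\<in>UNIV. X i)" "finite {i. X i \<noteq> topspace (discrete_topology (parcs G))}"
    "(\<Pi>\<^sub>E i\<in>UNIV. X i) \<subseteq> U"
    using product_topology_open_contains_basis[OF assms] by blast
  obtain N where N: "\<And>i. X i \<noteq> parcs G \<Longrightarrow> i < N"
    using X(2) by (auto simp: finite_nat_set_iff_bounded)
  show ?thesis
  proof (rule that[of N])
    fix e' assume e': "\<forall>i. e' i \<in> parcs G" "\<forall>i<N. e' i = e i"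
    have "e' i \<in> X i" for i
      using e' N[of i] X(1) by (cases "X i = parcs G") (auto simp: PiE_UNIV_domain)
    then show "e' \<in> U" using X(3) by (auto simp: PiE_UNIV_domain)
  qed
qed

lemma openin_chain_topology_cylinder:
  assumes "openin (chain_topology G) U" "x \<in> U"
  shows "\<exists>N. cylinder G N x \<inter> chains G \<subseteq> U"
proof -
  obtain V where V: "openin (prod_topology (edge_sequences G) (edge_sequences G)) V" "U = V \<inter> chains G"
    using assms(1) by (auto simp: chain_topology_def openin_subtopology)
  obtain A B where AB: "openin (edge_sequences G) A" "openin (edge_sequences G) B"
    "fst x \<in> A" "snd x \<in> B" "A \<times> B \<subseteq> V"
  proof -
    have "(fst x, snd x) \<in> V" using V(2) assms(2) by simp
    then have "\<exists>A B. openin (edge_sequences G) A \<and> openin (edge_sequences G) B \<and>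
        fst x \<in> A \<and> snd x \<in> B \<and> A \<times> B \<subseteq> V"
      using V(1) unfolding openin_prod_topology_alt by blast
    then show ?thesis using that by blast
  qed
  obtain M where M: "\<And>e'. (\<forall>i. e' i \<in> parcs G) \<Longrightarrow> (\<forall>i<M. e' i = fst x i) \<Longrightarrow> e' \<in> A"
    using openin_edge_sequences_cylinder[OF AB(1,3)] by blast
  obtain N where N: "\<And>e'. (\<forall>i. e' i \<in> parcs G) \<Longrightarrow> (\<forall>i<N. e' i = snd x i) \<Longrightarrow> e' \<in> B"
    using openin_edge_sequences_cylinder[OF AB(2,4)] by blast
  have "cylinder G (max M N) x \<inter> chains G \<subseteq> U"
  proof
    fix y assume y: "y \<in> cylinder G (max M N) x \<inter> chains G"
    then have "fst y \<in> A" "snd y \<in> B"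
      by (auto simp: cylinder_def intro!: M N)
    then show "y \<in> U" using AB(5) V(2) y by (cases y) auto
  qed
  then show ?thesis by blast
qed

text \<open>Local constancy gives a depth for each chain separately; compactness makes it uniform.
  \<open>N\<close> is the largest depth in a finite subcover, so two chains agreeing up to
  \<open>N\<close> lie in a common cylinder of the subcover.\<close>

lemma locally_constant_finite_depth:
  assumes fin: "finite (parcs G)" and f: "locally_constant G f"
  obtains N where "\<And>x y. x \<in> chains G \<Longrightarrow> y \<in> chains G \<Longrightarrow>
    (\<And>i. i < N \<Longrightarrow> fst x i = fst y i \<and> snd x i = snd y i) \<Longrightarrow> f x = f y"
proof -
  have "\<exists>N. \<forall>y \<in> cylinder G N x \<inter> chains G. f y = f x" if x: "x \<in> chains G" for x
  proof -
    obtain U where U: "openin (chain_topology G) U" "x \<in> U" "\<forall>y\<in>U. f y = f x"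
      using f x unfolding locally_constant_def by blast
    show ?thesis using openin_chain_topology_cylinder[OF U(1,2)] U(3) by blast
  qed
  then obtain n where n: "\<And>x y. x \<in> chains G \<Longrightarrow> y \<in> cylinder G (n x) x \<inter> chains G \<Longrightarrow> f y = f x"
    by metis
  let ?C = "\<lambda>x. cylinder G (n x) x \<inter> chains G"
  have top: "topspace (chain_topology G) = chains G"
    using chains_subset by (auto simp: chain_topology_def)
  have "openin (chain_topology G) (?C x)" if "x \<in> chains G" for x
    using openin_cylinder[OF mem_cylinder_chains[OF that]]
    unfolding chain_topology_def openin_subtopology by blast
  moreover have "chains G \<subseteq> \<Union> (?C ` chains G)"
    using mem_cylinder_chains by blast
  moreover have "compactin (chain_topology G) (chains G)"
    using compact_space_chain_topology[OF fin] by (simp add: compact_space_def top)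
  ultimately have "\<exists>\<F>. finite \<F> \<and> \<F> \<subseteq> ?C ` chains G \<and> chains G \<subseteq> \<Union>\<F>"
    by (intro compactinD) blast+
  then obtain \<F> where F: "finite \<F>" "\<F> \<subseteq> ?C ` chains G" "chains G \<subseteq> \<Union>\<F>"
    by blast
  obtain X where X: "finite X" "X \<subseteq> chains G" "\<F> = ?C ` X"
    using finite_subset_image[OF F(1,2)] by blast
  obtain N where N: "\<And>x. x \<in> X \<Longrightarrow> n x \<le> N"
    using finite_nat_set_iff_bounded_le[of "n ` X"] X(1) by auto
  show ?thesis
  proof (rule that[of N])
    fix y z assume yz: "y \<in> chains G" "z \<in> chains G"
      "\<And>i. i < N \<Longrightarrow> fst y i = fst z i \<and> snd y i = snd z i"
    obtain x where x: "x \<in> X" "y \<in> ?C x" using F(3) X(3) yz(1) by blast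
    have "z \<in> ?C x"
      using x N[OF x(1)] yz mem_cylinder_chains[OF yz(2), of 0] by (auto simp: cylinder_def)
    then show "f y = f z" using n[of x y] n[of x z] x X(2) by auto
  qed
qed

text \<open>After \<open>N\<close> shifts, the \<open>N\<close> nearest edges on either side of the
  origin are the first 2 * \<open>N\<close> forward edges of the original chain. The past is thereby
  eliminated.\<close>

lemma locally_constant_window:
  assumes fin: "finite (parcs G)" and f: "locally_constant G f"
  obtains N g where "N \<ge> 1"
    "\<And>x. x \<in> chains G \<Longrightarrow> f ((shift ^^ N) x) = g (map (fst x) [0..<2 * N])"
proof -
  obtain N0 where N0: "\<And>x y. x \<in> chains G \<Longrightarrow> y \<in> chains G \<Longrightarrow>
    (\<And>i. i < N0 \<Longrightarrow> fst x i = fst y i \<and> snd x i = snd y i) \<Longrightarrow> f x = f y"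
    using locally_constant_finite_depth[OF assms] by blast
  \<comment> \<open>The successor keeps \<open>N\<close> positive, so that words have length at
    least 2 and record an adjacent pair of edges.\<close>
  define N where "N = Suc N0"
  have eq: "f ((shift ^^ N) x) = f ((shift ^^ N) y)"
    if "x \<in> chains G" "y \<in> chains G" "map (fst x) [0..<2 * N] = map (fst y) [0..<2 * N]" for x y
  proof (rule N0)
    have *: "fst x i = fst y i" if "i < 2 * N" for i
      using \<open>map (fst x) [0..<2 * N] = map (fst y) [0..<2 * N]\<close> that by auto
    fix i assume "i < N0"
    then have "i < N" by (simp add: N_def)
    then show "fst ((shift ^^ N) x) i = fst ((shift ^^ N) y) i \<and> snd ((shift ^^ N) x) i = snd ((shift ^^ N) y) i"
      using *[of "i + N"] *[of "N - 1 - i"] by (auto simp: fst_shift_pow snd_shift_pow)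
  qed (use that in \<open>auto intro: shift_pow_chains\<close>)
  \<comment> \<open>By \<open>eq\<close> any chain beginning with \<open>w\<close> gives the same
    value.\<close>
  define g where "g w = f ((shift ^^ N) (SOME x. x \<in> chains G \<and> map (fst x) [0..<2 * N] = w))" for w
  show ?thesis
  proof (rule that[of N g])
    fix x assume x: "x \<in> chains G"
    let ?y = "SOME y. y \<in> chains G \<and> map (fst y) [0..<2 * N] = map (fst x) [0..<2 * N]"
    have "?y \<in> chains G \<and> map (fst ?y) [0..<2 * N] = map (fst x) [0..<2 * N]"
      by (rule someI[of _ x]) (use x in simp)
    then show "f ((shift ^^ N) x) = g (map (fst x) [0..<2 * N])"
      unfolding g_def by (intro eq[OF x]) auto
  qed (simp add: N_def)
qed

section \<open>The transfer matrix\<close>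

definition index_lists :: "nat \<Rightarrow> nat \<Rightarrow> nat list set" where
  "index_lists d n = {xs. set xs \<subseteq> {..<d} \<and> length xs = n}"

lemma finite_index_lists: "finite (index_lists d n)"
  unfolding index_lists_def by (rule finite_lists_length_eq) simp

lemma sum_index_lists_Cons:
  "(\<Sum>xs\<in>index_lists d (Suc n). F xs) = (\<Sum>i<d. \<Sum>xs\<in>index_lists d n. F (i # xs))"
  unfolding sum.cartesian_product
  by (rule sum.reindex_bij_witness[where i = "\<lambda>(i, xs). i # xs" and j = "\<lambda>xs. (hd xs, tl xs)"])
    (auto simp: index_lists_def length_Suc_conv)

lemma sum_index_lists_snoc:
  "(\<Sum>xs\<in>index_lists d (Suc n). F xs) = (\<Sum>xs\<in>index_lists d n. \<Sum>i<d. F (xs @ [i]))"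
  unfolding sum.cartesian_product
  by (rule sum.reindex_bij_witness[where i = "\<lambda>(xs, i). xs @ [i]" and j = "\<lambda>xs. (butlast xs, last xs)"])
    (auto simp: index_lists_def length_Suc_conv_rev)

definition walk_prod :: "'a :: comm_ring_1 mat \<Rightarrow> nat list \<Rightarrow> 'a" where
  "walk_prod A ys = (\<Prod>k<length ys - 1. A $$ (ys ! k, ys ! Suc k))"

lemma walk_prod_snoc:
  assumes "ys \<noteq> []"
  shows "walk_prod A (ys @ [j]) = walk_prod A ys * A $$ (last ys, j)"
proof -
  obtain n where n: "length ys = Suc n" using assms by (cases ys) auto
  then show ?thesis
    using assms by (auto simp: walk_prod_def nth_append last_conv_nth intro!: prod.cong)
qed

lemma pow_mat_entry:
  assumes A: "A \<in> carrier_mat d d" and "i < d" "j < d"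
  shows "(A ^\<^sub>m Suc n) $$ (i, j) = (\<Sum>xs\<in>index_lists d n. walk_prod A (i # xs @ [j]))"
  using \<open>j < d\<close>
proof (induction n arbitrary: j)
  case 0
  have "index_lists d 0 = {[]}" by (auto simp: index_lists_def)
  moreover have "1\<^sub>m d * A = A" using A by simp
  ultimately show ?case using A by (simp add: walk_prod_def)
next
  case (Suc n)
  have "(A ^\<^sub>m Suc (Suc n)) $$ (i, j) = (\<Sum>l<d. (A ^\<^sub>m Suc n) $$ (i, l) * A $$ (l, j))"
    using A assms(2) Suc.prems by (simp add: scalar_prod_def atLeast0LessThan)
  also have "\<dots> = (\<Sum>l<d. \<Sum>xs\<in>index_lists d n. walk_prod A (i # xs @ [l]) * A $$ (l, j))"
    using Suc.IH by (simp add: sum_distrib_right)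
  also have "\<dots> = (\<Sum>xs\<in>index_lists d n. \<Sum>l<d. walk_prod A (i # (xs @ [l]) @ [j]))"
    using walk_prod_snoc[of "i # _ @ [_]" A j] by (subst sum.swap) simp
  also have "\<dots> = (\<Sum>xs\<in>index_lists d (Suc n). walk_prod A (i # xs @ [j]))"
    by (rule sum_index_lists_snoc[symmetric])
  finally show ?case .
qed

text \<open>On the diagonal the walk returns to its initial index \<open>i\<close>, so the product
  along \<open>i # xs @ [i]\<close> is the product along \<open>i # xs\<close> read
  cyclically.\<close>

lemma mat_trace_pow:
  fixes A :: "'a :: comm_ring_1 mat"
  assumes A: "A \<in> carrier_mat d d"
  shows "mat_trace (A ^\<^sub>m Suc n) =
    (\<Sum>xs\<in>index_lists d (Suc n). \<Prod>k<Suc n. A $$ (cyc xs k, cyc xs (Suc k)))"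
proof -
  have "mat_trace (A ^\<^sub>m Suc n) = (\<Sum>i<d. \<Sum>xs\<in>index_lists d n. walk_prod A (i # xs @ [i]))"
    using A pow_mat_entry[OF A] by (simp add: mat_trace_def del: pow_mat.simps)
  also have "\<dots> = (\<Sum>i<d. \<Sum>xs\<in>index_lists d n.
      \<Prod>k<Suc n. A $$ (cyc (i # xs) k, cyc (i # xs) (Suc k)))"
  proof (intro sum.cong refl)
    fix i xs assume "xs \<in> index_lists d n"
    then have len: "length xs = n" by (simp add: index_lists_def)
    have nth: "(i # xs @ [i]) ! k = cyc (i # xs) k" if "k \<le> Suc n" for k
    proof (cases "k = Suc n")
      case False
      then have "k < length (i # xs)" using that len by simp
      then show ?thesis by (metis append_Cons cyc_def mod_less nth_append)
    qed (simp add: cyc_def len nth_append)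
    have "length (i # xs @ [i]) - 1 = Suc n" using len by simp
    then show "walk_prod A (i # xs @ [i]) = (\<Prod>k<Suc n. A $$ (cyc (i # xs) k, cyc (i # xs) (Suc k)))"
      unfolding walk_prod_def using nth by (intro prod.cong) (simp_all only: lessThan_iff Suc_leI less_imp_le)
  qed
  also have "\<dots> = (\<Sum>xs\<in>index_lists d (Suc n). \<Prod>k<Suc n. A $$ (cyc xs k, cyc xs (Suc k)))"
    by (rule sum_index_lists_Cons[symmetric])
  finally show ?thesis .
qed

section \<open>Words, windows and the transfer matrix\<close>

definition words :: "'v pair_pre_digraph \<Rightarrow> nat \<Rightarrow> ('v \<times> 'v) list set" where
  "words G m = {w. set w \<subseteq> parcs G \<and> length w = m \<and>
     (\<forall>i. Suc i < m \<longrightarrow> admissible (w ! i) (w ! Suc i))}"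

lemma finite_words: "finite (parcs G) \<Longrightarrow> finite (words G m)"
  by (rule finite_subset[OF _ finite_lists_length_eq[of "parcs G" m]]) (auto simp: words_def)

definition window :: "(nat \<Rightarrow> 'a) \<Rightarrow> nat \<Rightarrow> nat \<Rightarrow> 'a list" where
  "window e m k = map (\<lambda>j. e (k + j)) [0..<m]"

lemma window_cyc_words:
  assumes "pair_graph G" "closed_path G p"
  shows "window (cyc p) m k \<in> words G m"
  using assms by (auto simp: words_def window_def closed_path_iff)

lemma tl_window: "tl (window e m k) = butlast (window e m (Suc k))"
  by (intro nth_equalityI) (auto simp: window_def nth_tl nth_butlast)

lemma hd_window: "m > 0 \<Longrightarrow> hd (window e m k) = e k"
  by (simp add: window_def hd_map)

text \<open>Letter j of a word is letter j - 1 of the next word; after j moves it is the head of the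
  j-th successor. Hence the heads determine all words.\<close>

lemma overlapping_words_eq_window:
  assumes len: "\<And>i. length (W i) = m" and "\<And>i. tl (W i) = butlast (W (Suc i))"
  shows "W i = window (\<lambda>i. hd (W i)) m i"
proof (rule nth_equalityI)
  have "W i ! j = hd (W (i + j))" if "j < m" for i j
    using that
  proof (induction j arbitrary: i)
    case 0
    then show ?case using len[of i] by (subst hd_conv_nth) auto
  next
    case (Suc j)
    have "W i ! Suc j = tl (W i) ! j" using Suc.prems len by (simp add: nth_tl)
    also have "\<dots> = W (Suc i) ! j" using Suc.prems len by (simp add: assms(2) nth_butlast)
    finally show ?case using Suc by simp
  qed
  then show "W i ! j = window (\<lambda>i. hd (W i)) m i ! j" if "j < length (W i)" for j
    using that len by (simp add: window_def)
qed (simp add: len window_def)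

text \<open>The overlap condition is that of a de Bruijn graph. Admissibility of the appended edge
  needs no extra clause: for words of length at least 2 it is part of the successor being a word.
  The list \<open>ws\<close> only supplies the matrix indices.\<close>

definition transfer_mat ::
    "('v \<times> 'v) list list \<Rightarrow> (('v \<times> 'v) list \<Rightarrow> complex) \<Rightarrow> complex \<Rightarrow> complex mat" where
  "transfer_mat ws g \<beta> = mat (length ws) (length ws)
     (\<lambda>(i, j). if tl (ws ! i) = butlast (ws ! j) then exp (- \<beta> * g (ws ! i)) else 0)"

lemma transfer_mat_carrier: "transfer_mat ws g \<beta> \<in> carrier_mat (length ws) (length ws)"
  by (simp add: transfer_mat_def)

lemma cyc_mem: "xs \<noteq> [] \<Longrightarrow> cyc xs k \<in> set xs"
  by (simp add: cyc_def)

text \<open>A cyclic sequence of words contributes exactly when neighbours overlap, and it is then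
  the sequence of windows of the path formed by the heads: \<open>dec\<close> takes heads and
  \<open>enc\<close> takes windows. Windows longer than the path simply wrap around.\<close>

lemma mat_trace_transfer_mat:
  fixes G :: "'v pair_pre_digraph"
  assumes G: "pair_graph G" and ws: "distinct ws" "set ws = words G m" and m: "m \<ge> 2"
  shows "mat_trace (transfer_mat ws g \<beta> ^\<^sub>m Suc n) =
    (\<Sum>p | closed_path G p \<and> length p = Suc n. exp (- \<beta> * (\<Sum>k<Suc n. g (window (cyc p) m k))))"
proof -
  let ?d = "length ws" and ?T = "transfer_mat ws g \<beta>"
  define W where "W xs k = ws ! cyc xs k" for xs k
  define adj where "adj xs \<longleftrightarrow> (\<forall>k<Suc n. tl (W xs k) = butlast (W xs (Suc k)))" for xs
  define wt where "wt xs = exp (- \<beta> * (\<Sum>k<Suc n. g (W xs k)))" for xs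
  define ix where "ix w = (SOME i. i < ?d \<and> ws ! i = w)" for w
  have ix: "ix w < ?d \<and> ws ! ix w = w" if "w \<in> words G m" for w
  proof -
    have "\<exists>i. i < ?d \<and> ws ! i = w" using that ws(2) by (metis in_set_conv_nth)
    then show ?thesis unfolding ix_def by (rule someI_ex)
  qed
  have ix_nth: "ix (ws ! i) = i" if "i < ?d" for i
    using ix[of "ws ! i"] that ws(2) nth_mem[OF that] nth_eq_iff_index_eq[OF ws(1)] by metis
  have cyc_lt: "cyc xs k < ?d" if "xs \<in> index_lists ?d (Suc n)" for xs k
  proof -
    have "xs \<noteq> []" "set xs \<subseteq> {..<?d}" using that by (auto simp: index_lists_def)
    then show ?thesis using cyc_mem[of xs k] by blast
  qed
  have Ww: "W xs k \<in> words G m" if "xs \<in> index_lists ?d (Suc n)" for xs k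
    using nth_mem[OF cyc_lt[OF that]] ws(2) by (simp add: W_def)
  have prod: "(\<Prod>k<Suc n. ?T $$ (cyc xs k, cyc xs (Suc k))) = (if adj xs then wt xs else 0)"
    if "xs \<in> index_lists ?d (Suc n)" for xs
  proof -
    have T: "?T $$ (cyc xs k, cyc xs (Suc k)) =
        (if tl (W xs k) = butlast (W xs (Suc k)) then exp (- \<beta> * g (W xs k)) else 0)" for k
      using cyc_lt[OF that, of k] cyc_lt[OF that, of "Suc k"] by (simp add: transfer_mat_def W_def)
    show ?thesis
    proof (cases "adj xs")
      case True
      then have "(\<Prod>k<Suc n. ?T $$ (cyc xs k, cyc xs (Suc k))) = (\<Prod>k<Suc n. exp (- \<beta> * g (W xs k)))"
        unfolding T adj_def by (intro prod.cong) auto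
      also have "\<dots> = wt xs"
        unfolding wt_def sum_distrib_left by (rule exp_sum[symmetric]) simp
      finally show ?thesis using True by simp
    next
      case False
      then have "\<exists>k\<in>{..<Suc n}. ?T $$ (cyc xs k, cyc xs (Suc k)) = 0"
        unfolding T adj_def by auto
      then show ?thesis using False by (simp add: prod_zero_iff del: prod.lessThan_Suc)
    qed
  qed
  \<comment> \<open>The overlaps are required over one turn; periodicity extends them to all
    positions, as needed to read off entire windows.\<close>
  have adj_all: "tl (W xs k) = butlast (W xs (Suc k))"
    if "xs \<in> index_lists ?d (Suc n)" "adj xs" for xs k
  proof -
    have "length xs = Suc n" using that by (simp add: index_lists_def)
    then have "cyc xs k = cyc xs (k mod Suc n)" "cyc xs (Suc k) = cyc xs (Suc (k mod Suc n))"
      by (simp_all add: cyc_def mod_Suc_eq)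
    then show ?thesis using that(2) unfolding adj_def W_def by simp
  qed
  have W_eq: "W xs k = window (\<lambda>i. hd (W xs i)) m k"
    if "xs \<in> index_lists ?d (Suc n)" "adj xs" for xs k
    using Ww[OF that(1)] adj_all[OF that] by (intro overlapping_words_eq_window) (auto simp: words_def)
  define enc where "enc p = map (\<lambda>i. ix (window (cyc p) m i)) [0..<Suc n]"
    for p :: "('v \<times> 'v) list"
  define dec where "dec xs = map (\<lambda>i. hd (ws ! i)) xs" for xs
  have cyc_dec: "cyc (dec xs) k = hd (W xs k)" if "xs \<in> index_lists ?d (Suc n)" for xs k
    using that by (simp add: cyc_def dec_def W_def index_lists_def)
  have cyc_enc: "cyc (enc p) k = ix (window (cyc p) m k)" if "length p = Suc n" for p k
  proof -
    have "window (cyc p) m (k mod Suc n) = window (cyc p) m k"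
      using that by (simp add: window_def cyc_def mod_add_left_eq)
    moreover have "enc p ! (k mod Suc n) = ix (window (cyc p) m (k mod Suc n))"
      unfolding enc_def by (subst nth_map) (simp_all del: upt_Suc)
    ultimately show ?thesis by (simp add: cyc_def enc_def)
  qed
  have W_enc: "W (enc p) k = window (cyc p) m k" if "closed_path G p" "length p = Suc n" for p k
    using ix window_cyc_words[OF G that(1)] cyc_enc[OF that(2)] by (simp add: W_def)
  have "mat_trace (?T ^\<^sub>m Suc n) = (\<Sum>xs\<in>index_lists ?d (Suc n). if adj xs then wt xs else 0)"
    unfolding mat_trace_pow[OF transfer_mat_carrier] using prod by (rule sum.cong[OF refl])
  also have "\<dots> = (\<Sum>xs | xs \<in> index_lists ?d (Suc n) \<and> adj xs. wt xs)"
    by (simp add: sum.If_cases finite_index_lists Int_def conj_commute)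
  also have "\<dots> = (\<Sum>p | closed_path G p \<and> length p = Suc n.
      exp (- \<beta> * (\<Sum>k<Suc n. g (window (cyc p) m k))))"
  proof (rule sum.reindex_bij_witness[where i = enc and j = dec])
    fix xs assume "xs \<in> {xs. xs \<in> index_lists ?d (Suc n) \<and> adj xs}"
    then have xs: "xs \<in> index_lists ?d (Suc n)" "adj xs" by auto
    then have len: "length xs = Suc n" "length (dec xs) = Suc n" by (simp_all add: index_lists_def dec_def)
    have win: "window (cyc (dec xs)) m k = W xs k" for k
      unfolding W_eq[OF xs, of k] window_def cyc_dec[OF xs(1)] ..
    show "enc (dec xs) = xs"
    proof (rule cyc_eqI)
      show "cyc (enc (dec xs)) k = cyc xs k" for k
        unfolding cyc_enc[OF len(2)] win unfolding W_def using ix_nth[OF cyc_lt[OF xs(1)]] .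
    qed (simp add: enc_def len)
    show "dec xs \<in> {p. closed_path G p \<and> length p = Suc n}"
    proof -
      have "cyc (dec xs) k \<in> parcs G" "admissible (cyc (dec xs) k) (cyc (dec xs) (Suc k))" for k
      proof -
        have w: "window (cyc (dec xs)) m k \<in> words G m" unfolding win by (rule Ww[OF xs(1)])
        then have "window (cyc (dec xs)) m k ! 0 \<in> parcs G"
          "admissible (window (cyc (dec xs)) m k ! 0) (window (cyc (dec xs)) m k ! Suc 0)"
          using m by (auto simp: words_def intro: nth_mem)
        then show "cyc (dec xs) k \<in> parcs G" "admissible (cyc (dec xs) k) (cyc (dec xs) (Suc k))"
          using m by (auto simp: window_def)
      qed
      then show ?thesis using len by (auto simp: closed_path_iff[OF G])
    qed
    show "exp (- \<beta> * (\<Sum>k<Suc n. g (window (cyc (dec xs)) m k))) = wt xs"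
      unfolding win wt_def ..
  next
    fix p assume "p \<in> {p. closed_path G p \<and> length p = Suc n}"
    then have p: "closed_path G p" "length p = Suc n" by auto
    have enc: "enc p \<in> index_lists ?d (Suc n)"
      using ix window_cyc_words[OF G p(1)] by (auto simp: index_lists_def enc_def)
    show "dec (enc p) = p"
    proof (rule cyc_eqI)
      show "cyc (dec (enc p)) k = cyc p k" for k
        unfolding cyc_dec[OF enc] W_enc[OF p] using m by (simp add: hd_window)
    qed (simp add: p dec_def enc_def)
    show "enc p \<in> {xs. xs \<in> index_lists ?d (Suc n) \<and> adj xs}"
    proof (intro CollectI conjI enc)
      show "adj (enc p)" unfolding adj_def W_enc[OF p] using tl_window by blast
    qed
  qed
  finally show ?thesis .
qed

text \<open>Of the q + 1 edges leaving the end of \<open>a\<close>, the reversal of \<open>a\<close>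
  is excluded.\<close>

lemma card_admissible_successors_le:
  assumes "regular_graph (q + 1) G" "a \<in> parcs G"
  shows "card {b \<in> parcs G. admissible a b} \<le> q"
proof -
  interpret pair_graph G using assms(1) by (simp add: regular_graph_def)
  have sw: "prod.swap a \<in> parcs G"
    using pair_sym_arcs assms(2) by (cases a) (auto simp: symmetric_def sym_def)
  have "card {b \<in> parcs G. fst b = snd a} = q + 1"
    using assms arc_snd_in_verts[OF assms(2)]
    by (auto simp: regular_graph_def out_degree_def out_arcs_def)
  moreover have "{b \<in> parcs G. admissible a b} = {b \<in> parcs G. fst b = snd a} - {prod.swap a}"
    by (auto simp: admissible_def)
  ultimately show ?thesis using sw by simp
qed

text \<open>A successor of \<open>w\<close> is determined by its last edge. Its position m - 2 holds
  the last edge of \<open>w\<close>, so the new edge is one of the at most \<open>q\<close>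
  admissible continuations.\<close>

lemma card_words_successors_le:
  assumes reg: "regular_graph (q + 1) G" and w: "w \<in> words G m" and m: "m \<ge> 2"
  shows "card {w' \<in> words G m. tl w = butlast w'} \<le> q"
proof -
  have fin: "finite (parcs G)"
    using reg by (auto simp: regular_graph_def pair_graph_def pair_digraph_def pair_fin_digraph_def
        pair_fin_digraph_axioms_def)
  let ?S = "{w' \<in> words G m. tl w = butlast w'}"
  have len: "length w' = m" "w' \<noteq> []" if "w' \<in> words G m" for w' :: "('a \<times> 'a) list"
    using that m by (auto simp: words_def)
  have "inj_on last ?S"
    by (rule inj_onI) (metis (mono_tags, lifting) append_butlast_last_id len(2) mem_Collect_eq)
  moreover have "last ` ?S \<subseteq> {b \<in> parcs G. admissible (last w) b}"
  proof (rule image_subsetI)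
    fix w' assume "w' \<in> ?S"
    then have w': "w' \<in> words G m" "tl w = butlast w'" by auto
    have "w' ! (m - 2) = butlast w' ! (m - 2)"
      using len[OF w'(1)] m by (simp add: nth_butlast)
    also have "\<dots> = tl w ! (m - 2)" by (simp add: w'(2))
    also have "\<dots> = w ! (m - 1)"
      using len[OF w] m by (simp add: nth_tl Suc_diff_Suc numeral_2_eq_2)
    finally have "last w = w' ! (m - 2)" using len[OF w] by (simp add: last_conv_nth)
    moreover have "last w' = w' ! Suc (m - 2)"
      using len[OF w'(1)] m by (simp add: last_conv_nth Suc_diff_Suc numeral_2_eq_2)
    moreover have "last w' \<in> parcs G"
      using w'(1) len[OF w'(1)] by (auto simp: words_def)
    moreover have "admissible (w' ! (m - 2)) (w' ! Suc (m - 2))"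
      using w'(1) m by (auto simp: words_def)
    ultimately show "last w' \<in> {b \<in> parcs G. admissible (last w) b}" by simp
  qed
  ultimately have "card ?S \<le> card {b \<in> parcs G. admissible (last w) b}"
    using fin by (intro card_inj_on_le[of last]) auto
  moreover have "last w \<in> parcs G" using w len[OF w] by (auto simp: words_def)
  ultimately show ?thesis
    using card_admissible_successors_le[OF reg] by (meson le_trans)
qed

lemma transfer_mat_row_sum_le:
  assumes reg: "regular_graph (q + 1) G" and ws: "distinct ws" "set ws = words G m" and m: "m \<ge> 2"
    and F: "\<And>w. w \<in> words G m \<Longrightarrow> norm (g w) \<le> F" and i: "i < length ws"
  shows "(\<Sum>j<length ws. norm (transfer_mat ws g \<beta> $$ (i, j))) \<le> real q * exp (norm \<beta> * F)"
proof -
  have w: "ws ! i \<in> words G m" using i ws(2) nth_mem by blast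
  have "norm (exp (- \<beta> * g (ws ! i))) \<le> exp (norm (- \<beta> * g (ws ! i)))"
    by (rule norm_exp)
  also have "\<dots> \<le> exp (norm \<beta> * F)"
    using F[OF w] by (simp add: norm_mult mult_left_mono)
  finally have bound: "norm (exp (- \<beta> * g (ws ! i))) \<le> exp (norm \<beta> * F)" .
  let ?J = "{j. j < length ws \<and> tl (ws ! i) = butlast (ws ! j)}"
  have "(\<Sum>j<length ws. norm (transfer_mat ws g \<beta> $$ (i, j))) =
      (\<Sum>j<length ws. if tl (ws ! i) = butlast (ws ! j) then norm (exp (- \<beta> * g (ws ! i))) else 0)"
    using i by (intro sum.cong) (auto simp: transfer_mat_def)
  also have "\<dots> = real (card ?J) * norm (exp (- \<beta> * g (ws ! i)))"
    by (simp add: sum.If_cases Int_def lessThan_def)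
  also have "\<dots> \<le> real q * exp (norm \<beta> * F)"
  proof (rule mult_mono[OF _ bound])
    have "inj_on (nth ws) ?J"
      using ws(1) by (auto simp: inj_on_def nth_eq_iff_index_eq)
    moreover have "nth ws ` ?J \<subseteq> {w' \<in> words G m. tl (ws ! i) = butlast w'}"
    proof (rule image_subsetI)
      fix j assume "j \<in> ?J"
      then have "j < length ws" "tl (ws ! i) = butlast (ws ! j)" by simp_all
      then show "ws ! j \<in> {w' \<in> words G m. tl (ws ! i) = butlast w'}"
        using nth_mem[of j ws] unfolding ws(2) by simp
    qed
    moreover have "finite {w' \<in> words G m. tl (ws ! i) = butlast w'}"
      by (rule finite_subset[OF _ List.finite_set[of ws, unfolded ws(2)]]) auto
    ultimately have "card ?J \<le> card {w' \<in> words G m. tl (ws ! i) = butlast w'}"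
      by (rule card_inj_on_le)
    also have "\<dots> \<le> q" by (rule card_words_successors_le[OF reg w m])
    finally show "real (card ?J) \<le> real q" by simp
  qed auto
  finally show ?thesis .
qed

lemma periodic_chain_chains:
  assumes "pair_graph G" "closed_path G p"
  shows "periodic_chain p \<in> chains G"
proof -
  let ?n = "length p"
  have ne: "p \<noteq> []" and arc: "\<And>i. cyc p i \<in> parcs G"
    and adm: "\<And>i. admissible (cyc p i) (cyc p (Suc i))"
    using assms by (auto simp: closed_path_iff)
  have n: "?n > 0" using ne by simp
  have b: "p ! (?n - 1 - i mod ?n) = cyc p (?n - 1 - i mod ?n)" for i
    using n by (simp add: cyc_def)
  have "cyc p (?n - 1 - i mod ?n) = cyc p (Suc (?n - 1 - Suc i mod ?n))" for i
  proof (cases "Suc (i mod ?n) = ?n")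
    case True
    then have "?n - 1 - i mod ?n = 0" by simp
    moreover have "Suc i mod ?n = 0" using True by (simp add: mod_Suc)
    ultimately show ?thesis using n by (simp add: cyc_def)
  next
    case False
    have "i mod ?n < ?n" using n by simp
    then have "?n - 1 - i mod ?n = Suc (?n - 1 - Suc i mod ?n)" using False by (simp add: mod_Suc)
    then show ?thesis by simp
  qed
  then have "admissible (p ! (?n - 1 - Suc i mod ?n)) (p ! (?n - 1 - i mod ?n))" for i
    unfolding b using adm by metis
  moreover have "admissible (p ! (?n - 1 - 0 mod ?n)) (p ! (0 mod ?n))"
    using adm[of "?n - 1"] n by (simp add: cyc_def)
  ultimately show ?thesis
    using arc adm arc[of "?n - 1 - _ mod ?n", folded b]
    unfolding chains_def periodic_chain_def cyc_def by blast
qed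

lemma fst_shift_pow_periodic_chain: "fst ((shift ^^ k) (periodic_chain p)) j = cyc p (k + j)"
  by (simp add: fst_shift_pow periodic_chain_def cyc_def add.commute)

section \<open>Continuation in one and two variables\<close>

text \<open>
  Joint holomorphy alone does not immediately yield that \<open>\<partial>\<^sub>\<beta> H (s, 0)\<close> is holomorphic in \<open>s\<close>, so this
  is carried along in the closure properties.
\<close>

definition entire_C2 :: "(complex \<times> complex \<Rightarrow> complex) \<Rightarrow> bool" where
  "entire_C2 H \<longleftrightarrow> (\<lambda>s. H (s, 0)) holomorphic_on UNIV \<and>
     (\<exists>A B. (\<forall>z. (H has_derivative (\<lambda>h. A z * fst h + B z * snd h)) (at z)) \<and>
        (\<lambda>s. B (s, 0)) holomorphic_on UNIV)"

lemma entire_C2_fst: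
  assumes "\<phi> holomorphic_on UNIV"
  shows "entire_C2 (\<lambda>z. \<phi> (fst z))"
proof -
  have "((\<lambda>z. \<phi> (fst z)) has_derivative (\<lambda>h. deriv \<phi> (fst z) * fst h + 0 * snd h)) (at z)"
    for z :: "complex \<times> complex"
  proof -
    have "(\<phi> has_derivative (*) (deriv \<phi> (fst z))) (at (fst z))"
      using holomorphic_derivI[OF assms open_UNIV] by (simp add: has_field_derivative_def)
    then have "((\<lambda>z. \<phi> (fst z)) has_derivative (\<lambda>h. deriv \<phi> (fst z) * fst h)) (at z)"
      by (rule has_derivative_compose[OF has_derivative_fst[OF has_derivative_ident]])
    then show ?thesis by simp
  qed
  then show ?thesis using assms
    unfolding entire_C2_def by (intro conjI exI[of _ "\<lambda>z. deriv \<phi> (fst z)"] exI[of _ "\<lambda>z. 0"]) auto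
qed

lemma entire_C2_snd:
  assumes "\<psi> holomorphic_on UNIV"
  shows "entire_C2 (\<lambda>z. \<psi> (snd z))"
proof -
  have "((\<lambda>z. \<psi> (snd z)) has_derivative (\<lambda>h. 0 * fst h + deriv \<psi> (snd z) * snd h)) (at z)"
    for z :: "complex \<times> complex"
  proof -
    have "(\<psi> has_derivative (*) (deriv \<psi> (snd z))) (at (snd z))"
      using holomorphic_derivI[OF assms open_UNIV] by (simp add: has_field_derivative_def)
    then have "((\<lambda>z. \<psi> (snd z)) has_derivative (\<lambda>h. deriv \<psi> (snd z) * snd h)) (at z)"
      by (rule has_derivative_compose[OF has_derivative_snd[OF has_derivative_ident]])
    then show ?thesis by simp
  qed
  then show ?thesis
    unfolding entire_C2_def by (intro conjI exI[of _ "\<lambda>z. deriv \<psi> (snd z)"] exI[of _ "\<lambda>z. 0"]) auto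
qed

lemma entire_C2_const: "entire_C2 (\<lambda>z. c)"
  using entire_C2_fst[of "\<lambda>_. c"] by simp

lemma entire_C2_add:
  assumes "entire_C2 H" "entire_C2 K"
  shows "entire_C2 (\<lambda>z. H z + K z)"
proof -
  obtain A B where H: "\<And>z. (H has_derivative (\<lambda>h. A z * fst h + B z * snd h)) (at z)"
    "(\<lambda>s. B (s, 0)) holomorphic_on UNIV" "(\<lambda>s. H (s, 0)) holomorphic_on UNIV"
    using assms(1) unfolding entire_C2_def by blast
  obtain A' B' where K: "\<And>z. (K has_derivative (\<lambda>h. A' z * fst h + B' z * snd h)) (at z)"
    "(\<lambda>s. B' (s, 0)) holomorphic_on UNIV" "(\<lambda>s. K (s, 0)) holomorphic_on UNIV"
    using assms(2) unfolding entire_C2_def by blast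
  have "((\<lambda>z. H z + K z) has_derivative (\<lambda>h. (A z + A' z) * fst h + (B z + B' z) * snd h)) (at z)" for z
    by (rule has_derivative_eq_rhs[OF has_derivative_add[OF H(1) K(1)]]) (auto simp: algebra_simps)
  then show ?thesis unfolding entire_C2_def
    by (intro conjI exI[of _ "\<lambda>z. A z + A' z"] exI[of _ "\<lambda>z. B z + B' z"] allI holomorphic_intros H K)
qed

lemma entire_C2_mult:
  assumes "entire_C2 H" "entire_C2 K"
  shows "entire_C2 (\<lambda>z. H z * K z)"
proof -
  obtain A B where H: "\<And>z. (H has_derivative (\<lambda>h. A z * fst h + B z * snd h)) (at z)"
    "(\<lambda>s. B (s, 0)) holomorphic_on UNIV" "(\<lambda>s. H (s, 0)) holomorphic_on UNIV"
    using assms(1) unfolding entire_C2_def by blast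
  obtain A' B' where K: "\<And>z. (K has_derivative (\<lambda>h. A' z * fst h + B' z * snd h)) (at z)"
    "(\<lambda>s. B' (s, 0)) holomorphic_on UNIV" "(\<lambda>s. K (s, 0)) holomorphic_on UNIV"
    using assms(2) unfolding entire_C2_def by blast
  have "((\<lambda>z. H z * K z) has_derivative
      (\<lambda>h. (H z * A' z + A z * K z) * fst h + (H z * B' z + B z * K z) * snd h)) (at z)" for z
    by (rule has_derivative_eq_rhs[OF has_derivative_mult[OF H(1) K(1)]]) (auto simp: algebra_simps)
  then show ?thesis unfolding entire_C2_def
    by (intro conjI exI[of _ "\<lambda>z. H z * A' z + A z * K z"] exI[of _ "\<lambda>z. H z * B' z + B z * K z"]
        allI holomorphic_intros H K)
qed

lemma entire_C2_sum: "(\<And>i. i \<in> I \<Longrightarrow> entire_C2 (H i)) \<Longrightarrow> entire_C2 (\<lambda>z. \<Sum>i\<in>I. H i z)"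
  by (induction I rule: infinite_finite_induct) (auto intro: entire_C2_const entire_C2_add)

lemma entire_C2_prod: "(\<And>i. i \<in> I \<Longrightarrow> entire_C2 (H i)) \<Longrightarrow> entire_C2 (\<lambda>z. \<Prod>i\<in>I. H i z)"
  by (induction I rule: infinite_finite_induct) (auto intro: entire_C2_const entire_C2_mult)

text \<open>By the Leibniz formula the determinant is a polynomial in the entries.\<close>

lemma entire_C2_det:
  assumes "\<And>z. A z \<in> carrier_mat d d"
    and "\<And>i j. i < d \<Longrightarrow> j < d \<Longrightarrow> entire_C2 (\<lambda>z. A z $$ (i, j))"
  shows "entire_C2 (\<lambda>z. det (A z))"
proof -
  have "(\<lambda>z. det (A z)) = (\<lambda>z. \<Sum>p | p permutes {0..<d}. signof p * (\<Prod>i = 0..<d. A z $$ (i, p i)))"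
    using det_def'[OF assms(1)] by blast
  moreover have "p i < d" if "p permutes {0..<d}" "i < d" for p i
    using permutes_in_image[OF that(1), of i] that(2) by simp
  ultimately show ?thesis
    using assms(2) by (auto intro!: entire_C2_sum entire_C2_mult entire_C2_prod entire_C2_const)
qed

lemma entire_C2_holomorphic_C2: "entire_C2 H \<Longrightarrow> holomorphic_C2 H"
  unfolding entire_C2_def holomorphic_C2_def by blast

section \<open>Identity theorems for the two continuations\<close>

lemma has_derivative_snd_section:
  assumes "(H has_derivative (\<lambda>h. a * fst h + b * snd h)) (at (s, \<beta>))"
  shows "((\<lambda>\<beta>. H (s, \<beta>)) has_field_derivative b) (at \<beta>)"
proof -
  have "((\<lambda>\<beta>. (s, \<beta>)) has_derivative (\<lambda>h. (0, h))) (at \<beta>)"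
    by (auto intro!: derivative_eq_intros)
  from has_derivative_compose[OF this assms] show ?thesis
    by (simp add: has_field_derivative_def)
qed

lemma has_derivative_fst_section:
  assumes "(H has_derivative (\<lambda>h. a * fst h + b * snd h)) (at (s, \<beta>))"
  shows "((\<lambda>s. H (s, \<beta>)) has_field_derivative a) (at s)"
proof -
  have "((\<lambda>s. (s, \<beta>)) has_derivative (\<lambda>h. (h, 0))) (at s)"
    by (auto intro!: derivative_eq_intros)
  from has_derivative_compose[OF this assms] show ?thesis
    by (simp add: has_field_derivative_def)
qed

lemma holomorphic_C2_sections:
  assumes "holomorphic_C2 H"
  shows "(\<lambda>\<beta>. H (s, \<beta>)) holomorphic_on UNIV" "(\<lambda>s. H (s, \<beta>)) holomorphic_on UNIV"
  using assms has_derivative_snd_section has_derivative_fst_section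
  unfolding holomorphic_C2_def holomorphic_on_open[OF open_UNIV] by metis+

lemma entire_C2_deriv_snd:
  assumes "entire_C2 H"
  shows "(\<lambda>s. deriv (\<lambda>\<beta>. H (s, \<beta>)) 0) holomorphic_on UNIV"
proof -
  obtain A B where H: "\<And>z. (H has_derivative (\<lambda>h. A z * fst h + B z * snd h)) (at z)"
    "(\<lambda>s. B (s, 0)) holomorphic_on UNIV"
    using assms(1) unfolding entire_C2_def by blast
  have "deriv (\<lambda>\<beta>. H (s, \<beta>)) 0 = B (s, 0)" for s
    using has_derivative_snd_section[OF H(1)] by (intro DERIV_imp_deriv)
  then show ?thesis using H(2) by simp
qed

text \<open>The neighbourhood of \<beta> = 0 may depend on s without any uniformity. The
  one-variable identity theorem is therefore applied in \<beta> for each fixed s in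
  \<open>U\<close>, and then in s for each fixed \<beta>.\<close>

lemma holomorphic_C2_eqI:
  assumes H: "holomorphic_C2 H" and K: "holomorphic_C2 K"
    and U: "open U" "U \<noteq> {}" and eq: "\<And>s. s \<in> U \<Longrightarrow> \<forall>\<^sub>F \<beta> in nhds 0. H (s, \<beta>) = K (s, \<beta>)"
  shows "H = K"
proof
  fix z :: "complex \<times> complex"
  obtain s0 where s0: "s0 \<in> U" using U by blast
  have entire_eq: "h w = k w"
    if "h holomorphic_on UNIV" "k holomorphic_on UNIV" "open V" "x \<in> V" "\<And>y. y \<in> V \<Longrightarrow> h y = k y"
    for h k :: "complex \<Rightarrow> complex" and V x w
    using analytic_continuation_open[of V UNIV h k w] that by auto
  have all: "H (s, \<beta>) = K (s, \<beta>)" if s: "s \<in> U" for s \<beta>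
  proof -
    obtain V where V: "open V" "0 \<in> V" "\<And>\<beta>. \<beta> \<in> V \<Longrightarrow> H (s, \<beta>) = K (s, \<beta>)"
      using eq[OF s] unfolding eventually_nhds by blast
    show ?thesis
      by (rule entire_eq[OF holomorphic_C2_sections(1)[OF H] holomorphic_C2_sections(1)[OF K] V])
  qed
  have "H (fst z, snd z) = K (fst z, snd z)"
    by (rule entire_eq[OF holomorphic_C2_sections(2)[OF H] holomorphic_C2_sections(2)[OF K] U(1) s0 all])
  then show "H z = K z" by simp
qed

text \<open>The difference vanishes off a sparse set or is nonzero off one, and agreement near a
  point of \<open>U\<close> excludes the latter. Equality at the exceptional points follows because
  a nicely meromorphic function is recovered from its values nearby.\<close>

lemma nicely_meromorphic_on_UNIV_eqI:
  assumes Z: "Z nicely_meromorphic_on UNIV" and Y: "Y nicely_meromorphic_on UNIV"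
    and U: "open U" "U \<noteq> {}" and eq: "\<And>s. s \<in> U \<Longrightarrow> Z s = Y s"
  shows "Z = Y"
proof
  fix z
  have mero: "Z meromorphic_on UNIV" "Y meromorphic_on UNIV"
    using Z Y by (simp_all add: nicely_meromorphic_on_def)
  obtain s0 where s0: "s0 \<in> U" using U by blast
  have "\<not> eventually (\<lambda>z. Z z - Y z \<noteq> 0) (cosparse UNIV)"
  proof
    assume "eventually (\<lambda>z. Z z - Y z \<noteq> 0) (cosparse UNIV)"
    then have "eventually (\<lambda>z. Z z - Y z \<noteq> 0) (at s0)"
      by (simp add: eventually_cosparse_open_eq)
    moreover have "eventually (\<lambda>z. Z z = Y z) (at s0)"
      using eq U(1) s0 eventually_at_topological by blast
    ultimately have "eventually (\<lambda>z. False) (at s0)" by eventually_elim simp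
    then show False by simp
  qed
  then have "eventually (\<lambda>z. Z z - Y z = 0) (cosparse UNIV)"
    using meromorphic_imp_constant_or_avoid[of "\<lambda>z. Z z - Y z" UNIV 0] mero
    by (auto intro: meromorphic_intros)
  then have near: "eventually (\<lambda>z. Z z = Y z) (at z)"
    by (simp add: eventually_cosparse_open_eq)
  have remove: "remove_sings X z = X z" if "X nicely_meromorphic_on UNIV" for X
  proof -
    have "is_pole X z \<and> X z = 0 \<or> X \<midarrow>z\<rightarrow> X z"
      using that by (simp add: nicely_meromorphic_on_def)
    then show ?thesis by (elim disjE conjE) (simp, rule remove_sings_eqI)
  qed
  have "remove_sings Z z = remove_sings Y z"
    using near by (rule remove_sings_cong) simp
  then show "Z z = Y z" using remove Z Y by simp
qed

section \<open>The dynamical determinant as a determinant\<close>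

text \<open>The interface between combinatorics and analysis: from here on words and local constancy
  no longer appear. \<open>F\<close> bounds the weight per edge, and \<open>row\<close> controls the
  spectrum for all \<beta>.\<close>

locale transfer_data =
  fixes G :: "'v pair_pre_digraph" and q d :: nat and f :: "'v chain \<Rightarrow> complex"
    and M :: "complex \<Rightarrow> complex mat" and F :: real
  assumes graph: "pair_graph G" and q: "q > 1" and F: "0 \<le> F"
    and carrier: "\<And>\<beta>. M \<beta> \<in> carrier_mat d d"
    and entry: "\<And>i j. i < d \<Longrightarrow> j < d \<Longrightarrow>
      (\<forall>\<beta>. M \<beta> $$ (i, j) = 0) \<or> (\<exists>c. \<forall>\<beta>. M \<beta> $$ (i, j) = exp (- \<beta> * c))"
    and row: "\<And>\<beta> i. i < d \<Longrightarrow> (\<Sum>j<d. norm (M \<beta> $$ (i, j))) \<le> real q * exp (norm \<beta> * F)"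
    and trace: "\<And>\<beta> n. mat_trace (M \<beta> ^\<^sub>m Suc n) =
      (\<Sum>p | closed_path G p \<and> length p = Suc n. exp (- \<beta> * path_weight f p))"
    and weight: "\<And>p. closed_path G p \<Longrightarrow> norm (path_weight f p) \<le> real (length p) * F"
begin

abbreviation paths :: "nat \<Rightarrow> ('v \<times> 'v) list set" where
  "paths n \<equiv> {p. closed_path G p \<and> length p = n}"

lemma finite_paths: "finite (paths n)"
proof -
  interpret pair_graph G by (rule graph)
  show ?thesis
    by (rule finite_subset[OF _ finite_lists_length_eq[OF pair_finite_arcs, of n]])
      (auto simp: closed_path_def)
qed

text \<open>At \<beta> = 0 the trace counts the closed paths of the given length, so the spectral
  bound becomes a counting bound.\<close>

lemma card_paths_le: "real (card (paths n)) \<le> real d * real q ^ n"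
proof (cases n)
  case 0
  then have "paths n = {}" by (auto simp: closed_path_def)
  then show ?thesis by (simp only: card.empty) simp
next
  case (Suc m)
  have "norm (mat_trace (M 0 ^\<^sub>m Suc m)) \<le> real d * (real q * exp (norm (0::complex) * F)) ^ Suc m"
    by (rule norm_trace_pow_le[OF carrier row])
  then show ?thesis unfolding trace Suc by simp
qed

text \<open>There are at most d * q^n closed paths of length n, which leaves a geometric series of
  ratio r * q.\<close>

lemma summable_on_closed_paths:
  fixes h :: "('v \<times> 'v) list \<Rightarrow> complex"
  assumes h: "\<And>p. closed_path G p \<Longrightarrow> norm (h p) \<le> C * r ^ length p"
    and r: "0 \<le> r" "r * real q < 1" and C: "0 \<le> C"
  shows "h summable_on {p. closed_path G p}"
proof -
  have bij: "bij_betw snd (SIGMA n:UNIV. paths n) {p. closed_path G p}"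
    by (rule bij_betwI[where g = "\<lambda>p. (length p, p)"]) auto
  have le: "(\<Sum>p\<in>paths n. norm (h p)) \<le> C * real d * (r * real q) ^ n" for n
  proof -
    have "(\<Sum>p\<in>paths n. norm (h p)) \<le> (\<Sum>p\<in>paths n. C * r ^ n)"
      using h by (intro sum_mono) auto
    also have "\<dots> \<le> (real d * real q ^ n) * (C * r ^ n)"
      unfolding sum_constant using card_paths_le r C by (intro mult_right_mono) auto
    finally show ?thesis by (simp add: power_mult_distrib mult_ac)
  qed
  have "summable (\<lambda>n. \<Sum>p\<in>paths n. norm (h p))"
  proof (rule summable_comparison_test_ev)
    show "summable (\<lambda>n. C * real d * (r * real q) ^ n)"
      using r by (intro summable_mult summable_geometric) auto
    show "\<forall>\<^sub>F n in sequentially. norm (\<Sum>p\<in>paths n. norm (h p)) \<le> C * real d * (r * real q) ^ n"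
      using le by (simp add: sum_nonneg)
  qed
  then have "(\<lambda>n. \<Sum>p\<in>paths n. norm (h p)) summable_on UNIV"
    by (subst summable_on_UNIV_nonneg_real_iff) (auto intro: sum_nonneg)
  then have "(\<lambda>x. norm (h (snd x))) summable_on (SIGMA n:UNIV. paths n)"
    using has_sum_finite[OF finite_paths] by (intro summable_on_SigmaI) auto
  then have "(\<lambda>p. norm (h p)) summable_on {p. closed_path G p}"
    using summable_on_reindex_bij_betw[OF bij, of "\<lambda>p. norm (h p)"] by simp
  then show ?thesis by (rule abs_summable_summable)
qed

lemma sums_closed_paths:
  fixes h :: "('v \<times> 'v) list \<Rightarrow> complex"
  assumes h: "h summable_on {p. closed_path G p}"
  shows "(\<lambda>n. \<Sum>p\<in>paths (Suc n). h p) sums infsum h {p. closed_path G p}"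
proof -
  have bij: "bij_betw snd (SIGMA n:UNIV. paths n) {p. closed_path G p}"
    by (rule bij_betwI[where g = "\<lambda>p. (length p, p)"]) auto
  have "((\<lambda>x. h (snd x)) has_sum infsum h {p. closed_path G p}) (SIGMA n:UNIV. paths n)"
    unfolding has_sum_reindex_bij_betw[OF bij] using h by (rule has_sum_infsum)
  then have "((\<lambda>n. \<Sum>p\<in>paths n. h p) has_sum infsum h {p. closed_path G p}) UNIV"
    by (rule has_sum_SigmaD) (simp add: has_sum_finite[OF finite_paths])
  then have "(\<lambda>n. \<Sum>p\<in>paths n. h p) sums infsum h {p. closed_path G p}"
    by (rule has_sum_imp_sums)
  moreover have "(\<Sum>p\<in>paths 0. h p) = 0"
    by (rule sum.neutral) (auto simp: closed_path_def)
  ultimately show ?thesis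
    using sums_Suc_iff[of "\<lambda>n. \<Sum>p\<in>paths n. h p"] by simp
qed

section \<open>The determinant and zeta series on the half-plane\<close>

definition u :: "complex \<Rightarrow> complex" where
  "u s = of_nat q powr (1/2 + \<i> * s)"

lemma powr_eq_u_power: "of_nat q powr ((1/2 + \<i> * s) * of_nat n) = u s ^ n"
  using q by (simp add: u_def powr_def mult_ac flip: exp_of_nat_mult)

lemma holomorphic_u: "u holomorphic_on UNIV"
proof -
  have "u = (\<lambda>s. exp ((1/2 + \<i> * s) * Ln (of_nat q)))"
    using q by (auto simp: u_def powr_def)
  then show ?thesis by (auto intro!: holomorphic_intros)
qed

text \<open>This is the origin of 3/2: |u| equals q to the power 1/2 - Im s, and multiplying by
  \<open>q\<close> adds 1 to the exponent. The second bound serves the geometric series inside the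
  zeta function.\<close>

lemma norm_u_less:
  assumes "Im s > 3/2"
  shows "norm (u s) * real q < 1" "norm (u s) < 1"
proof -
  have "norm (u s) = real q powr (1/2 - Im s)"
    using norm_powr_real_powr[of "of_nat q" "1/2 + \<i> * s"] q by (simp add: u_def)
  moreover have "real q powr (1/2 - Im s) * real q = real q powr (1/2 - Im s + 1)"
    using q by (subst powr_add) simp
  moreover have "real q powr (1/2 - Im s + 1) < real q powr 0"
    using q assms by (intro powr_less_mono) auto
  moreover have "real q powr (1/2 - Im s) < real q powr 0"
    using q assms by (intro powr_less_mono) auto
  ultimately show "norm (u s) * real q < 1" "norm (u s) < 1" using q by simp_all
qed

lemma small_ball:
  assumes "Im s > 3/2"
  obtains \<epsilon> where "\<epsilon> > 0" "norm (u s) * (real q * exp (\<epsilon> * F)) < 1"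
proof -
  have "((\<lambda>\<epsilon>. norm (u s) * (real q * exp (\<epsilon> * F))) \<longlongrightarrow> norm (u s) * (real q * exp (0 * F))) (at_right 0)"
    by (intro tendsto_intros)
  then have "\<forall>\<^sub>F \<epsilon> in at_right 0. norm (u s) * (real q * exp (\<epsilon> * F)) < 1"
    using norm_u_less[OF assms] by (intro order_tendstoD(2)) auto
  moreover have "\<forall>\<^sub>F \<epsilon> in at_right (0::real). \<epsilon> > 0"
    by (rule eventually_at_right_less)
  ultimately have "\<forall>\<^sub>F \<epsilon> in at_right 0. \<epsilon> > 0 \<and> norm (u s) * (real q * exp (\<epsilon> * F)) < 1"
    by eventually_elim simp
  then show ?thesis using that eventually_happens'[OF trivial_limit_at_right_real] by blast
qed

definition D :: "complex \<times> complex \<Rightarrow> complex" where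
  "D z = det (1\<^sub>m d - u (fst z) \<cdot>\<^sub>m M (snd z))"

lemma entire_C2_D: "entire_C2 D"
  unfolding D_def
proof (rule entire_C2_det)
  show "1\<^sub>m d - u (fst z) \<cdot>\<^sub>m M (snd z) \<in> carrier_mat d d" for z
    using carrier[of "snd z"] by auto
  fix i j assume ij: "i < d" "j < d"
  have "entire_C2 (\<lambda>z. M (snd z) $$ (i, j))"
  proof -
    have "(\<lambda>\<beta>. exp (- \<beta> * c)) holomorphic_on UNIV" for c :: complex
      by (intro holomorphic_intros)
    then have "entire_C2 (\<lambda>z. exp (- snd z * c))" for c
      by (rule entire_C2_snd)
    then show ?thesis
      using entry[OF ij] entire_C2_const[of 0] by (elim disjE exE) (simp_all only:)
  qed
  \<comment> \<open>The difference is rewritten with a factor -1, matching closure under sums and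
    products.\<close>
  then have "entire_C2 (\<lambda>z. (if i = j then 1 else 0) + (- 1) * (u (fst z) * M (snd z) $$ (i, j)))"
    using entire_C2_fst[OF holomorphic_u] by (intro entire_C2_add entire_C2_mult entire_C2_const)
  moreover have "(1\<^sub>m d - u (fst z) \<cdot>\<^sub>m M (snd z)) $$ (i, j) =
      (if i = j then 1 else 0) + (- 1) * (u (fst z) * M (snd z) $$ (i, j))" for z
    using carrier[of "snd z"] ij by auto
  ultimately show "entire_C2 (\<lambda>z. (1\<^sub>m d - u (fst z) \<cdot>\<^sub>m M (snd z)) $$ (i, j))"
    by simp
qed

lemma norm_exp_weight_le:
  assumes "closed_path G p" "norm \<beta> \<le> b"
  shows "norm (exp (- \<beta> * path_weight f p)) \<le> exp (b * F) ^ length p"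
proof -
  have "norm (exp (- \<beta> * path_weight f p)) \<le> exp (norm (- \<beta> * path_weight f p))"
    by (rule norm_exp)
  also have "norm (- \<beta> * path_weight f p) \<le> b * (real (length p) * F)"
    unfolding norm_mult norm_minus_cancel
    using assms(2) weight[OF assms(1)] order_trans[OF norm_ge_zero assms(2)]
    by (intro mult_mono) auto
  also have "exp (b * (real (length p) * F)) = exp (b * F) ^ length p"
    by (simp add: mult_ac flip: exp_of_nat_mult)
  finally show ?thesis by simp
qed

text \<open>The k-th powers of the l members of a class each carry 1/(k * l), which adds up to the
  factor 1/k of the series. Summability over all pairs justifies the iterated sum.\<close>

lemma det_series_eq_exp:
  assumes "norm (u s) * (real q * exp (norm \<beta> * F)) < 1"
  shows "det_series G q f s \<beta> =
    exp (- (\<Sum>n. u s ^ Suc n / of_nat (Suc n) * mat_trace (M \<beta> ^\<^sub>m Suc n)))"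
proof -
  define h where "h p = u s ^ length p / of_nat (length p) * exp (- \<beta> * path_weight f p)" for p
  define a where "a k c = u s ^ (k * class_length c) / of_nat k * exp (- of_nat k * \<beta> * class_weight f c)"
    for k c
  have summable: "h summable_on {p. closed_path G p}"
  proof (rule summable_on_closed_paths[where C = 1 and r = "norm (u s) * exp (norm \<beta> * F)"])
    fix p assume p: "closed_path G p"
    then have "length p \<ge> 1" by (simp add: closed_path_def)
    then have "norm (u s) ^ length p / real (length p) \<le> norm (u s) ^ length p"
      using mult_left_mono[of 1 "real (length p)" "norm (u s) ^ length p"] by (simp add: divide_le_eq)
    then have "norm (h p) \<le> norm (u s) ^ length p * exp (norm \<beta> * F) ^ length p"
      unfolding h_def norm_mult norm_divide norm_power norm_of_nat
      using norm_exp_weight_le[OF p order_refl] by (intro mult_mono) auto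
    then show "norm (h p) \<le> 1 * (norm (u s) * exp (norm \<beta> * F)) ^ length p"
      by (simp only: power_mult_distrib mult_1)
  qed (use assms in \<open>auto simp: mult_ac\<close>)
  have a: "of_nat (length r) * h (concat (replicate k r)) = a k c"
    if k: "k \<ge> 1" and c: "c \<in> primitive_classes G" and r: "r \<in> c" for k c r
  proof -
    note len = class_length_eq[OF graph c r]
    have "r \<noteq> []" using len(5) by simp
    then show ?thesis
      using k len(5) path_weight_concat_replicate[of k r f]
      by (simp add: h_def a_def len(1,2) length_concat_replicate mult_ac)
  qed
  note sums = infsum_primitive_classes[OF graph summable a]
  have powr: "of_nat q powr ((1/2 + \<i> * s) * of_nat k * of_nat n) = u s ^ (k * n)" for k n
    using powr_eq_u_power[of s "k * n"] by (simp add: mult.assoc)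
  have "det_series G q f s \<beta> = exp (- (\<Sum>\<^sub>\<infinity>k\<in>{1..}. \<Sum>\<^sub>\<infinity>c\<in>primitive_classes G. a k c))"
    unfolding det_series_def powr a_def ..
  also have "(\<Sum>\<^sub>\<infinity>k\<in>{1..}. \<Sum>\<^sub>\<infinity>c\<in>primitive_classes G. a k c) = infsum h {p. closed_path G p}"
    using infsum_Sigma'_banach[OF sums(1)] sums(2) by simp
  also have "\<dots> = (\<Sum>n. \<Sum>p\<in>paths (Suc n). h p)"
    using sums_closed_paths[OF summable] by (simp add: sums_iff)
  also have "\<dots> = (\<Sum>n. u s ^ Suc n / of_nat (Suc n) * mat_trace (M \<beta> ^\<^sub>m Suc n))"
    unfolding trace sum_distrib_left by (intro suminf_cong sum.cong) (auto simp: h_def)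
  finally show ?thesis .
qed

lemma det_series_eq_D:
  assumes "norm (u s) * (real q * exp (norm \<beta> * F)) < 1"
  shows "det_series G q f s \<beta> = D (s, \<beta>)"
  unfolding det_series_eq_exp[OF assms] D_def fst_conv snd_conv
  by (rule det_eq_exp_trace_series[OF carrier row assms])

text \<open>The k-th power of \<open>r\<close> has k times the weight of \<open>r\<close>, which
  cancels the 1/k. What remains is a geometric series in k, whose sum is the quotient in the
  definition of the zeta series.\<close>

lemma zeta_series_sums:
  assumes s: "Im s > 3/2"
  shows "(\<lambda>n. u s ^ Suc n / of_nat (Suc n) * (\<Sum>p\<in>paths (Suc n). path_weight f p)) sums zeta_series G q f s"
proof -
  define h where "h p = u s ^ length p / of_nat (length p) * path_weight f p" for p
  define a where "a k c = u s ^ (k * class_length c) * class_weight f c" for k c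
  have summable: "h summable_on {p. closed_path G p}"
  proof (rule summable_on_closed_paths[where C = F and r = "norm (u s)"])
    fix p assume p: "closed_path G p"
    then have "length p \<ge> 1" by (simp add: closed_path_def)
    then have "norm (h p) \<le> norm (u s) ^ length p / real (length p) * (real (length p) * F)"
      unfolding h_def norm_mult norm_divide norm_power norm_of_nat
      using weight[OF p] by (intro mult_left_mono) auto
    then show "norm (h p) \<le> F * norm (u s) ^ length p"
      using \<open>length p \<ge> 1\<close> by (auto simp: mult_ac split: if_splits)
  qed (use norm_u_less[OF s] F in auto)
  have a: "of_nat (length r) * h (concat (replicate k r)) = a k c"
    if k: "k \<ge> 1" and c: "c \<in> primitive_classes G" and r: "r \<in> c" for k c r
  proof -
    note len = class_length_eq[OF graph c r]
    have "r \<noteq> []" using len(5) by simp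
    then show ?thesis
      using k len(5) path_weight_concat_replicate[of k r f]
      by (simp add: h_def a_def len(1,2) length_concat_replicate)
  qed
  note sums = infsum_primitive_classes[OF graph summable a]
  have geometric: "(\<Sum>\<^sub>\<infinity>k\<in>{1..}. a k c) = u s ^ class_length c / (1 - u s ^ class_length c) * class_weight f c"
    if c: "c \<in> primitive_classes G" for c
  proof -
    obtain r where r: "r \<in> c" using primitive_class_nonempty[OF c] .
    define z where "z = u s ^ class_length c"
    have z: "norm z < 1"
      unfolding z_def norm_power
      using norm_u_less(2)[OF s] class_length_eq(1,5)[OF graph c r] by (intro power_less_one_iff[THEN iffD2]) auto
    have "((\<lambda>n. z ^ n) has_sum (1 / (1 - z))) UNIV"
      using z by (intro norm_summable_imp_has_sum geometric_sums) (auto simp: norm_power)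
    then have "((\<lambda>n. z * class_weight f c * z ^ n) has_sum (z * class_weight f c * (1 / (1 - z)))) UNIV"
      by (rule has_sum_cmult_right)
    moreover have "bij_betw Suc UNIV {1..}"
      by (rule bij_betwI[where g = "\<lambda>n. n - 1"]) auto
    ultimately have "((\<lambda>k. z ^ k * class_weight f c) has_sum (z * class_weight f c * (1 / (1 - z)))) {1..}"
      by (subst has_sum_reindex_bij_betw[symmetric, of Suc UNIV]) (simp_all add: mult_ac)
    then have "infsum (\<lambda>k. z ^ k * class_weight f c) {1..} = z * class_weight f c * (1 / (1 - z))"
      by (rule infsumI)
    then show ?thesis by (simp add: a_def z_def mult_ac flip: power_mult)
  qed
  have "zeta_series G q f s = (\<Sum>\<^sub>\<infinity>c\<in>primitive_classes G. \<Sum>\<^sub>\<infinity>k\<in>{1..}. a k c)"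
    unfolding zeta_series_def powr_eq_u_power using geometric by (intro infsum_cong) simp
  \<comment> \<open>The geometric sums require k innermost; summability over pairs allows the
    exchange.\<close>
  also have "\<dots> = (\<Sum>\<^sub>\<infinity>k\<in>{1..}. \<Sum>\<^sub>\<infinity>c\<in>primitive_classes G. a k c)"
    using infsum_swap_banach[OF sums(1)] by simp
  also have "\<dots> = infsum h {p. closed_path G p}"
    using infsum_Sigma'_banach[OF sums(1)] sums(2) by simp
  finally have "(\<lambda>n. \<Sum>p\<in>paths (Suc n). h p) sums zeta_series G q f s"
    using sums_closed_paths[OF summable] by simp
  moreover have "(\<Sum>p\<in>paths (Suc n). h p) = u s ^ Suc n / of_nat (Suc n) * (\<Sum>p\<in>paths (Suc n). path_weight f p)" for n
    unfolding sum_distrib_left by (intro sum.cong) (auto simp: h_def)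
  ultimately show ?thesis by simp
qed

text \<open>Near \<beta> = 0 one has D = exp (- g), so D does not vanish and its logarithmic
  derivative is - g'. Differentiating exp (- \<beta> W) brings down a second minus sign, whence the
  zeta series appears with a plus.\<close>

lemma D_log_deriv:
  assumes s: "Im s > 3/2"
  shows "D (s, 0) \<noteq> 0" "deriv (\<lambda>\<beta>. D (s, \<beta>)) 0 / D (s, 0) = zeta_series G q f s"
proof -
  obtain \<epsilon> where \<epsilon>: "\<epsilon> > 0" "norm (u s) * (real q * exp (\<epsilon> * F)) < 1"
    using small_ball[OF s] .
  define T where "T n \<beta> = u s ^ Suc n / of_nat (Suc n) * (\<Sum>p\<in>paths (Suc n). exp (- \<beta> * path_weight f p))"
    for n \<beta>
  define T' where "T' n \<beta> = u s ^ Suc n / of_nat (Suc n) *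
      (\<Sum>p\<in>paths (Suc n). - path_weight f p * exp (- \<beta> * path_weight f p))" for n \<beta>
  let ?r = "norm (u s) * (real q * exp (\<epsilon> * F))"
  have small: "norm (u s) * (real q * exp (norm \<beta> * F)) < 1" if "norm \<beta> < \<epsilon>" for \<beta> :: complex
  proof -
    have "norm (u s) * (real q * exp (norm \<beta> * F)) \<le> ?r"
      using that F by (intro mult_left_mono) (auto intro: mult_right_mono)
    then show ?thesis using \<epsilon>(2) by simp
  qed
  have deriv_T: "(T n has_field_derivative T' n \<beta>) (at \<beta>)" for n \<beta>
    unfolding T_def T'_def by (intro DERIV_cmult DERIV_sum) (auto intro!: derivative_eq_intros)
  have bound: "norm (T n \<beta>) \<le> real d * ?r ^ Suc n" if "norm \<beta> < \<epsilon>" for n \<beta>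
  proof -
    have "norm (T n \<beta>) = norm (u s) ^ Suc n / real (Suc n) * norm (mat_trace (M \<beta> ^\<^sub>m Suc n))"
      unfolding T_def trace norm_mult norm_divide norm_power norm_of_nat ..
    also have "\<dots> \<le> norm (u s) ^ Suc n * (real d * (real q * exp (norm \<beta> * F)) ^ Suc n)"
    proof (rule mult_mono)
      show "norm (u s) ^ Suc n / real (Suc n) \<le> norm (u s) ^ Suc n"
        using mult_left_mono[of 1 "real (Suc n)" "norm (u s) ^ Suc n"] by (simp add: divide_le_eq)
      show "norm (mat_trace (M \<beta> ^\<^sub>m Suc n)) \<le> real d * (real q * exp (norm \<beta> * F)) ^ Suc n"
        by (rule norm_trace_pow_le[OF carrier row])
    qed auto
    also have "\<dots> = real d * (norm (u s) * (real q * exp (norm \<beta> * F))) ^ Suc n"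
      by (simp only: power_mult_distrib mult_ac)
    also have "\<dots> \<le> real d * ?r ^ Suc n"
      using that F by (intro mult_left_mono power_mono) (auto intro: mult_right_mono)
    finally show ?thesis .
  qed
  obtain g g' where g: "\<forall>\<beta>\<in>ball 0 \<epsilon>. (\<lambda>n. T n \<beta>) sums g \<beta> \<and> (\<lambda>n. T' n \<beta>) sums g' \<beta> \<and>
      (g has_field_derivative g' \<beta>) (at \<beta>)"
  proof -
    have "\<exists>g g'. \<forall>\<beta>\<in>ball 0 \<epsilon>. (\<lambda>n. T n \<beta>) sums g \<beta> \<and> (\<lambda>n. T' n \<beta>) sums g' \<beta> \<and>
      (g has_field_derivative g' \<beta>) (at \<beta>)"
    \<comment> \<open>The majorant \<open>c\<close> is valid on the whole disc, so every point can
      use the same radius 1.\<close>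
    proof (rule series_and_derivative_comparison_complex[OF open_ball deriv_T])
      fix x :: complex
      define c where "c n = real d * ?r ^ Suc n" for n
      have c: "0 \<le> c n" for n by (simp add: c_def)
      have "summable c"
        unfolding c_def using \<epsilon>(2)
        by (intro summable_mult summable_ignore_initial_segment[of _ 1, simplified] summable_geometric) auto
      then have "summable (\<lambda>n. complex_of_real (c n))" by (rule summable_of_real)
      moreover have "range (\<lambda>n. complex_of_real (c n)) \<subseteq> \<real>\<^sub>\<ge>\<^sub>0"
        using c by auto
      moreover have "norm (T n y) \<le> norm (complex_of_real (c n))" if "norm y < \<epsilon>" for n y
        unfolding norm_of_real abs_of_nonneg[OF c] using bound[OF that] by (simp only: c_def)
      ultimately show "\<exists>\<delta> h. 0 < \<delta> \<and> summable h \<and> range h \<subseteq> \<real>\<^sub>\<ge>\<^sub>0 \<and>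
          (\<forall>\<^sub>F n in sequentially. \<forall>y\<in>ball x \<delta> \<inter> ball 0 \<epsilon>. norm (T n y) \<le> cmod (h n))"
        by (intro exI[of _ "1::real"] exI[of _ "\<lambda>n. complex_of_real (c n)"] conjI
            always_eventually allI ballI) simp_all
    qed
    then show ?thesis using that by blast
  qed
  have D_eq: "D (s, \<beta>) = exp (- g \<beta>)" if "\<beta> \<in> ball 0 \<epsilon>" for \<beta>
  proof -
    have small': "norm (u s) * (real q * exp (norm \<beta> * F)) < 1" using small that by simp
    have "D (s, \<beta>) = exp (- (\<Sum>n. T n \<beta>))"
      unfolding det_series_eq_D[OF small', symmetric] det_series_eq_exp[OF small'] trace T_def ..
    then show ?thesis using g that by (simp add: sums_iff)
  qed
  have "((\<lambda>\<beta>. exp (- g \<beta>)) has_field_derivative (exp (- g 0) * - g' 0)) (at 0)"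
    using g \<epsilon>(1) by (auto intro!: derivative_eq_intros)
  then have "((\<lambda>\<beta>. D (s, \<beta>)) has_field_derivative (exp (- g 0) * - g' 0)) (at 0)"
    by (rule has_field_derivative_transform_within_open[of _ _ _ "ball 0 \<epsilon>"]) (use \<epsilon>(1) D_eq in auto)
  then have "deriv (\<lambda>\<beta>. D (s, \<beta>)) 0 = exp (- g 0) * - g' 0"
    by (rule DERIV_imp_deriv)
  moreover have D0: "D (s, 0) = exp (- g 0)" using D_eq \<epsilon>(1) by simp
  moreover have "- g' 0 = zeta_series G q f s"
  proof -
    have "(\<lambda>n. - T' n 0) sums - g' 0" using g \<epsilon>(1) by (intro sums_minus) simp
    moreover have "- T' n 0 = u s ^ Suc n / of_nat (Suc n) * (\<Sum>p\<in>paths (Suc n). path_weight f p)" for n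
      by (simp add: T'_def sum_negf)
    ultimately show ?thesis using zeta_series_sums[OF s] sums_unique2 by auto
  qed
  ultimately show "deriv (\<lambda>\<beta>. D (s, \<beta>)) 0 / D (s, 0) = zeta_series G q f s" by simp
  show "D (s, 0) \<noteq> 0" unfolding D0 by simp
qed

section \<open>Identification of the two continuations\<close>

lemma open_half_plane: "open {s. Im s > 3/2}" "{s. Im s > 3/2} \<noteq> {}"
proof -
  show "open {s. Im s > 3/2}" by (rule open_halfspace_Im_gt)
  have "2 * \<i> \<in> {s. Im s > 3/2}" by simp
  then show "{s. Im s > 3/2} \<noteq> {}" by blast
qed

lemma dynamical_det_eq: "dynamical_det G q f = D"
  unfolding dynamical_det_def
proof (rule the_equality)
  have D: "\<forall>\<^sub>F \<beta> in nhds 0. D (s, \<beta>) = det_series G q f s \<beta>" if s: "Im s > 3/2" for s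
  proof -
    obtain \<epsilon> where \<epsilon>: "\<epsilon> > 0" "norm (u s) * (real q * exp (\<epsilon> * F)) < 1"
      using small_ball[OF s] .
    have "D (s, \<beta>) = det_series G q f s \<beta>" if "\<beta> \<in> ball 0 \<epsilon>" for \<beta>
    proof -
      have "norm (u s) * (real q * exp (norm \<beta> * F)) \<le> norm (u s) * (real q * exp (\<epsilon> * F))"
        using that F by (intro mult_left_mono) (auto intro: mult_right_mono)
      then show ?thesis using det_series_eq_D \<epsilon>(2) by simp
    qed
    then show ?thesis
      unfolding eventually_nhds using \<epsilon>(1) by (intro exI[of _ "ball 0 \<epsilon>"]) auto
  qed
  then show "holomorphic_C2 D \<and> (\<forall>s. Im s > 3/2 \<longrightarrow> (\<forall>\<^sub>F \<beta> in nhds 0. D (s, \<beta>) = det_series G q f s \<beta>))"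
    using entire_C2_holomorphic_C2[OF entire_C2_D] by blast
  fix H assume H: "holomorphic_C2 H \<and> (\<forall>s. Im s > 3/2 \<longrightarrow> (\<forall>\<^sub>F \<beta> in nhds 0. H (s, \<beta>) = det_series G q f s \<beta>))"
  show "H = D"
  proof (rule holomorphic_C2_eqI[OF _ entire_C2_holomorphic_C2[OF entire_C2_D] open_half_plane])
    fix s assume "s \<in> {s. Im s > 3/2}"
    then have "\<forall>\<^sub>F \<beta> in nhds 0. H (s, \<beta>) = det_series G q f s \<beta>"
      "\<forall>\<^sub>F \<beta> in nhds 0. D (s, \<beta>) = det_series G q f s \<beta>" using H D by auto
    then show "\<forall>\<^sub>F \<beta> in nhds 0. H (s, \<beta>) = D (s, \<beta>)" by eventually_elim simp
  qed (use H in blast)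
qed

lemma meromorphic_log_deriv:
  "(\<lambda>s. deriv (\<lambda>\<beta>. D (s, \<beta>)) 0 / D (s, 0)) meromorphic_on UNIV"
  using entire_C2_D entire_C2_deriv_snd[OF entire_C2_D]
  by (intro meromorphic_on_divide analytic_on_imp_meromorphic_on)
    (auto simp: analytic_on_open entire_C2_def)

text \<open>On the half-plane the denominator does not vanish, so the quotient is analytic there and
  \<open>remove_sings\<close> changes nothing. Elsewhere \<open>remove_sings\<close> produces the
  normal form that makes the continuation unique as a function.\<close>

lemma ihara_zeta_eq:
  "ihara_zeta G q f = remove_sings (\<lambda>s. deriv (\<lambda>\<beta>. D (s, \<beta>)) 0 / D (s, 0))"
proof -
  let ?L = "\<lambda>s. deriv (\<lambda>\<beta>. D (s, \<beta>)) 0 / D (s, 0)"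
  have nice: "remove_sings ?L nicely_meromorphic_on UNIV"
    by (rule remove_sings_nicely_meromorphic[OF meromorphic_log_deriv])
  have zeta: "remove_sings ?L s = zeta_series G q f s" if s: "Im s > 3/2" for s
  proof -
    have "(\<lambda>s. deriv (\<lambda>\<beta>. D (s, \<beta>)) 0) analytic_on {s}" "(\<lambda>s. D (s, 0)) analytic_on {s}"
      using entire_C2_D entire_C2_deriv_snd[OF entire_C2_D]
      by (auto simp: entire_C2_def analytic_on_open intro: analytic_on_subset[of _ UNIV])
    then have "?L analytic_on {s}"
      using D_log_deriv(1)[OF s] by (intro analytic_on_divide) auto
    then show ?thesis using D_log_deriv(2)[OF s] by simp
  qed
  show ?thesis
    unfolding ihara_zeta_def
  proof (rule the_equality)
    show "remove_sings ?L nicely_meromorphic_on UNIV \<and>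
        (\<forall>s. Im s > 3/2 \<longrightarrow> remove_sings ?L s = zeta_series G q f s)"
      using nice zeta by blast
    fix Z assume "Z nicely_meromorphic_on UNIV \<and> (\<forall>s. Im s > 3/2 \<longrightarrow> Z s = zeta_series G q f s)"
    then show "Z = remove_sings ?L"
      using zeta by (intro nicely_meromorphic_on_UNIV_eqI[OF _ nice open_half_plane]) auto
  qed
qed

end

lemma transfer_data_exists:
  assumes q: "q > 1" and reg: "regular_graph (q + 1) G" and f: "locally_constant G f"
  obtains d M F where "transfer_data G q d f M F"
proof -
  have G: "pair_graph G" using reg by (simp add: regular_graph_def)
  then interpret pair_graph G .
  obtain N g where N: "N \<ge> 1"
    and g: "\<And>x. x \<in> chains G \<Longrightarrow> f ((shift ^^ N) x) = g (map (fst x) [0..<2 * N])"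
    using locally_constant_window[OF pair_finite_arcs f] by blast
  define m where "m = 2 * N"
  have m: "m \<ge> 2" using N by (simp add: m_def)
  obtain ws where ws: "set ws = words G m" "distinct ws"
    using finite_distinct_list[OF finite_words[OF pair_finite_arcs]] by blast
  \<comment> \<open>A crude common bound for finitely many values.\<close>
  define F where "F = (\<Sum>w\<in>words G m. norm (g w))"
  have F: "norm (g w) \<le> F" if "w \<in> words G m" for w
    unfolding F_def using that finite_words[OF pair_finite_arcs] by (intro member_le_sum) auto
  have weight: "path_weight f p = (\<Sum>k<length p. g (window (cyc p) m k))" if p: "closed_path G p" for p
  proof -
    have ne: "p \<noteq> []" using p by (auto simp: closed_path_def)
    \<comment> \<open>Starting \<open>N\<close> steps later does not change a sum over a full
      period; this is why \<open>f\<close> may be replaced by a function of forward edges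
      only.\<close>
    have "path_weight f p = (\<Sum>k<length p. f ((shift ^^ (k + N)) (periodic_chain p)))"
      unfolding path_weight_def
      using sum_is_period_shift[OF is_period_shift_periodic_chain[OF ne]] by metis
    also have "\<dots> = (\<Sum>k<length p. f ((shift ^^ N) ((shift ^^ k) (periodic_chain p))))"
      by (simp add: add.commute[of _ N] funpow_add)
    also have "\<dots> = (\<Sum>k<length p. g (window (cyc p) m k))"
      using g[OF shift_pow_chains[OF periodic_chain_chains[OF G p]]]
      by (simp add: window_def m_def fst_shift_pow_periodic_chain cong: map_cong)
    finally show ?thesis .
  qed
  have "transfer_data G q (length ws) f (transfer_mat ws g) F"
  proof (rule transfer_data.intro)
    show "pair_graph G" by (rule G)
    show "q > 1" by (rule q)
    show "0 \<le> F" unfolding F_def by (simp add: sum_nonneg)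
    show "transfer_mat ws g \<beta> \<in> carrier_mat (length ws) (length ws)" for \<beta>
      by (rule transfer_mat_carrier)
    show "(\<forall>\<beta>. transfer_mat ws g \<beta> $$ (i, j) = 0) \<or>
        (\<exists>c. \<forall>\<beta>. transfer_mat ws g \<beta> $$ (i, j) = exp (- \<beta> * c))"
      if "i < length ws" "j < length ws" for i j
      using that by (cases "tl (ws ! i) = butlast (ws ! j)") (auto simp: transfer_mat_def)
    show "(\<Sum>j<length ws. norm (transfer_mat ws g \<beta> $$ (i, j))) \<le> real q * exp (norm \<beta> * F)"
      if "i < length ws" for \<beta> i
      using transfer_mat_row_sum_le[OF reg ws(2,1) m F that] .
    show "mat_trace (transfer_mat ws g \<beta> ^\<^sub>m Suc n) =
      (\<Sum>p | closed_path G p \<and> length p = Suc n. exp (- \<beta> * path_weight f p))" for \<beta> n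
      unfolding mat_trace_transfer_mat[OF G ws(2,1) m] using weight by (intro sum.cong) auto
    show "norm (path_weight f p) \<le> real (length p) * F" if "closed_path G p" for p
    proof -
      have "norm (path_weight f p) \<le> (\<Sum>k<length p. F)"
        unfolding weight[OF that] using F window_cyc_words[OF G that] by (intro sum_norm_le) auto
      then show ?thesis by simp
    qed
  qed
  then show ?thesis by (rule that)
qed

theorem proposition4p15:
  fixes G :: "'v pair_pre_digraph" and q :: nat and f :: "'v chain \<Rightarrow> complex"
  assumes "q > 1"
    and "regular_graph (q + 1) G"
    and "locally_constant G f"
  shows "(\<lambda>s. deriv (\<lambda>\<beta>. dynamical_det G q f (s, \<beta>)) 0 / dynamical_det G q f (s, 0))
           meromorphic_on UNIV \<and>
         (\<forall>s. ihara_zeta G q f s =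
           remove_sings
             (\<lambda>s. deriv (\<lambda>\<beta>. dynamical_det G q f (s, \<beta>)) 0 / dynamical_det G q f (s, 0)) s)"
proof -
  obtain d M F where "transfer_data G q d f M F"
    using transfer_data_exists[OF assms] .
  then interpret transfer_data G q d f M F .
  show ?thesis
    unfolding dynamical_det_eq ihara_zeta_eq using meromorphic_log_deriv by blast
qed

end
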